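(* Let $G, H$ be infinite finitely generated groups and let $1\le p<\infty$. Then $$\min\left\{\alpha_p^*(G),\alpha_p^*\big(\mathscr{L}_G(H)\big)\right\}\ge \frac{1}{p}\implies \alpha_p^*(G\wr H)\ge \frac{p\,\alpha_p^*(G)\,\alpha_p^*\big(\mathscr{L}_G(H)\big)}{p\,\alpha_p^*(G)+p\,\alpha_p^*\big(\mathscr{L}_G(H)\big)-1},$$ and $$\min\left\{\alpha_p^*(G),\alpha_p^*\big(\mathscr{L}_G(H)\big)\right\}\le \frac{1}{p}\implies \alpha_p^*(G\wr H)\ge \min\left\{\alpha_p^*(G),\alpha_p^*\big(\mathscr{L}_G(H)\big)\right\}.$$
   Context: The wreath product $G\wr H$ is the group of all pairs $(f,x)$ with $f:H\to G$ finitely supported (i.e. $f(z)=e_G$ for all but finitely many $z$) and $x\in H$, with product $(f,x)(g,y)=(z\mapsto f(z)g(x^{-1}z),\,xy)$. If $S$ generates $G$ and $T$ generates $H$, then $G\wr H$ is given the left-invariant word metric of the generating set $\{(\mathbf{e},t): t\in T\}\cup\{(\delta_s,e_H): s\in S\}$, where $\mathbf{e}:H\to G$ is constantly $e_G$ and $\delta_s:H\to G$ equals $s$ at $e_H$ and $e_G$ elsewhere. $\mathscr{L}_G(H)$ denotes the group $G\wr H$ equipped with the word metric obtained when the generating set of $G$ is taken to be $S=G\setminus\{e_G\}$ (so any two distinct elements of $G$ are at distance $1$), and $T$ is a finite symmetric generating set of $H$. For a group $\Gamma$ with a word metric $d_\Gamma$, $\alpha_p^*(\Gamma)$ is the supremum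 of all $\alpha\ge0$ for which there exist a Lipschitz map $f:\Gamma\to L_p$ and $c>0$ with $\|f(x)-f(y)\|_p\ge c\,d_\Gamma(x,y)^\alpha$ for all distinct $x,y\in \Gamma$; for $G$ and $G\wr H$ the word metrics come from finite symmetric generating sets, and the exponents do not depend on the choice. Here $L_p=L_p([0,1])$. *)

theory Defs
  imports "HOL-Algebra.Generated_Groups" "HOL-Analysis.Analysis"
begin

section \<open>Wreath products\<close>

text \<open>Functions from H to G are taken extensional, i.e. \<open>undefined\<close> outside \<open>carrier H\<close>, so that
  equality of elements of the record below is equality of maps on \<open>carrier H\<close>.\<close>

definition wreath ::
  "('g, 'm) monoid_scheme \<Rightarrow> ('h, 'n) monoid_scheme \<Rightarrow> (('h \<Rightarrow> 'g) \<times> 'h) monoid"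
where
  "wreath G H =
    \<lparr>carrier = {f \<in> carrier H \<rightarrow>\<^sub>E carrier G. finite {z \<in> carrier H. f z \<noteq> \<one>\<^bsub>G\<^esub>}} \<times> carrier H,
     monoid.mult = (\<lambda>(f, x) (g, y).
       ((\<lambda>z\<in>carrier H. f z \<otimes>\<^bsub>G\<^esub> g (inv\<^bsub>H\<^esub> x \<otimes>\<^bsub>H\<^esub> z)), x \<otimes>\<^bsub>H\<^esub> y)),
     monoid.one = ((\<lambda>z\<in>carrier H. \<one>\<^bsub>G\<^esub>), \<one>\<^bsub>H\<^esub>)\<rparr>"

definition wreath_gens ::
  "('g, 'm) monoid_scheme \<Rightarrow> ('h, 'n) monoid_scheme \<Rightarrow> 'g set \<Rightarrow> 'h set \<Rightarrow> (('h \<Rightarrow> 'g) \<times> 'h) set"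
where
  "wreath_gens G H S T =
     {((\<lambda>z\<in>carrier H. \<one>\<^bsub>G\<^esub>), t) | t. t \<in> T} \<union>
     {((\<lambda>z\<in>carrier H. if z = \<one>\<^bsub>H\<^esub> then s else \<one>\<^bsub>G\<^esub>), \<one>\<^bsub>H\<^esub>) | s. s \<in> S}"

text \<open>The group \<open>\<L>\<^sub>G(H)\<close> is \<^term>\<open>wreath G H\<close> with the word metric of the following generating set,
  which is infinite when G is.\<close>

definition lamplighter_gens ::
  "('g, 'm) monoid_scheme \<Rightarrow> ('h, 'n) monoid_scheme \<Rightarrow> 'h set \<Rightarrow> (('h \<Rightarrow> 'g) \<times> 'h) set"
where
  "lamplighter_gens G H T = wreath_gens G H (carrier G - {\<one>\<^bsub>G\<^esub>}) T"

lemma group_wreath: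
  assumes "group G" and "group H"
  shows "group (wreath G H)"
proof -
  interpret G: group G by fact
  interpret H: group H by fact
  have shift: "finite {z \<in> carrier H. f (x \<otimes>\<^bsub>H\<^esub> z) \<noteq> \<one>\<^bsub>G\<^esub>}"
    if "finite {z \<in> carrier H. f z \<noteq> \<one>\<^bsub>G\<^esub>}" "x \<in> carrier H" for f x
  proof (rule finite_subset)
    show "finite ((\<lambda>z. inv\<^bsub>H\<^esub> x \<otimes>\<^bsub>H\<^esub> z) ` {z \<in> carrier H. f z \<noteq> \<one>\<^bsub>G\<^esub>})"
      using that(1) by simp
    show "{z \<in> carrier H. f (x \<otimes>\<^bsub>H\<^esub> z) \<noteq> \<one>\<^bsub>G\<^esub>} \<subseteq>
        (\<lambda>z. inv\<^bsub>H\<^esub> x \<otimes>\<^bsub>H\<^esub> z) ` {z \<in> carrier H. f z \<noteq> \<one>\<^bsub>G\<^esub>}"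
    proof
      fix z assume z: "z \<in> {z \<in> carrier H. f (x \<otimes>\<^bsub>H\<^esub> z) \<noteq> \<one>\<^bsub>G\<^esub>}"
      then have "z = inv\<^bsub>H\<^esub> x \<otimes>\<^bsub>H\<^esub> (x \<otimes>\<^bsub>H\<^esub> z)"
        using that(2) by (simp add: H.m_assoc[symmetric])
      with z that(2) show "z \<in> (\<lambda>z. inv\<^bsub>H\<^esub> x \<otimes>\<^bsub>H\<^esub> z) ` {z \<in> carrier H. f z \<noteq> \<one>\<^bsub>G\<^esub>}"
        by blast
    qed
  qed
  have mem: "f z \<in> carrier G" if "f \<in> carrier H \<rightarrow>\<^sub>E carrier G" "z \<in> carrier H" for f z
    using that by (rule PiE_mem)
  show ?thesis
  proof (rule groupI)
    fix a b assume "a \<in> carrier (wreath G H)" "b \<in> carrier (wreath G H)"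
    then obtain f x g y where ab: "a = (f, x)" "b = (g, y)"
      and f: "f \<in> carrier H \<rightarrow>\<^sub>E carrier G" "finite {z \<in> carrier H. f z \<noteq> \<one>\<^bsub>G\<^esub>}"
      and g: "g \<in> carrier H \<rightarrow>\<^sub>E carrier G" "finite {z \<in> carrier H. g z \<noteq> \<one>\<^bsub>G\<^esub>}"
      and xy: "x \<in> carrier H" "y \<in> carrier H"
      by (auto simp: wreath_def)
    have "finite {z \<in> carrier H. f z \<otimes>\<^bsub>G\<^esub> g (inv\<^bsub>H\<^esub> x \<otimes>\<^bsub>H\<^esub> z) \<noteq> \<one>\<^bsub>G\<^esub>}"
    proof (rule finite_subset)
      show "finite ({z \<in> carrier H. f z \<noteq> \<one>\<^bsub>G\<^esub>} \<union>
          {z \<in> carrier H. g (inv\<^bsub>H\<^esub> x \<otimes>\<^bsub>H\<^esub> z) \<noteq> \<one>\<^bsub>G\<^esub>})"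
        using f g xy shift[of g "inv\<^bsub>H\<^esub> x"] by simp
    qed (use f g xy in auto)
    moreover have "{z \<in> carrier H. (\<lambda>z\<in>carrier H. f z \<otimes>\<^bsub>G\<^esub> g (inv\<^bsub>H\<^esub> x \<otimes>\<^bsub>H\<^esub> z)) z \<noteq> \<one>\<^bsub>G\<^esub>} =
        {z \<in> carrier H. f z \<otimes>\<^bsub>G\<^esub> g (inv\<^bsub>H\<^esub> x \<otimes>\<^bsub>H\<^esub> z) \<noteq> \<one>\<^bsub>G\<^esub>}"
      by auto
    ultimately show "a \<otimes>\<^bsub>wreath G H\<^esub> b \<in> carrier (wreath G H)"
      using xy by (auto simp: ab wreath_def mem[OF f(1)] mem[OF g(1)])
  next
    show "\<one>\<^bsub>wreath G H\<^esub> \<in> carrier (wreath G H)"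
      by (auto simp: wreath_def)
  next
    fix a b c
    assume "a \<in> carrier (wreath G H)" "b \<in> carrier (wreath G H)" "c \<in> carrier (wreath G H)"
    then obtain f x g y h z where abc: "a = (f, x)" "b = (g, y)" "c = (h, z)"
      and fgh: "f \<in> carrier H \<rightarrow>\<^sub>E carrier G" "g \<in> carrier H \<rightarrow>\<^sub>E carrier G"
        "h \<in> carrier H \<rightarrow>\<^sub>E carrier G"
      and xyz: "x \<in> carrier H" "y \<in> carrier H" "z \<in> carrier H"
      by (auto simp: wreath_def)
    have "f w \<otimes>\<^bsub>G\<^esub> g (inv\<^bsub>H\<^esub> x \<otimes>\<^bsub>H\<^esub> w) \<otimes>\<^bsub>G\<^esub> h (inv\<^bsub>H\<^esub> (x \<otimes>\<^bsub>H\<^esub> y) \<otimes>\<^bsub>H\<^esub> w) =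
        f w \<otimes>\<^bsub>G\<^esub> (g (inv\<^bsub>H\<^esub> x \<otimes>\<^bsub>H\<^esub> w) \<otimes>\<^bsub>G\<^esub> h (inv\<^bsub>H\<^esub> y \<otimes>\<^bsub>H\<^esub> (inv\<^bsub>H\<^esub> x \<otimes>\<^bsub>H\<^esub> w)))"
      if "w \<in> carrier H" for w
      using that xyz by (simp add: mem[OF fgh(1)] mem[OF fgh(2)] mem[OF fgh(3)]
          G.m_assoc H.m_assoc H.inv_mult_group)
    then show "a \<otimes>\<^bsub>wreath G H\<^esub> b \<otimes>\<^bsub>wreath G H\<^esub> c = a \<otimes>\<^bsub>wreath G H\<^esub> (b \<otimes>\<^bsub>wreath G H\<^esub> c)"
      using xyz by (simp add: abc wreath_def H.m_assoc cong: restrict_cong)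
  next
    fix a assume "a \<in> carrier (wreath G H)"
    then obtain f x where a: "a = (f, x)" and f: "f \<in> carrier H \<rightarrow>\<^sub>E carrier G"
      and x: "x \<in> carrier H"
      by (auto simp: wreath_def)
    have "(\<lambda>z\<in>carrier H. f z) = f"
      using f by (simp add: PiE_def extensional_restrict)
    then show "\<one>\<^bsub>wreath G H\<^esub> \<otimes>\<^bsub>wreath G H\<^esub> a = a"
      using x by (simp add: a wreath_def mem[OF f] cong: restrict_cong)
  next
    fix a assume "a \<in> carrier (wreath G H)"
    then obtain f x where a: "a = (f, x)"
      and f: "f \<in> carrier H \<rightarrow>\<^sub>E carrier G" "finite {z \<in> carrier H. f z \<noteq> \<one>\<^bsub>G\<^esub>}"
      and x: "x \<in> carrier H"
      by (auto simp: wreath_def)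
    let ?b = "((\<lambda>z\<in>carrier H. inv\<^bsub>G\<^esub> (f (x \<otimes>\<^bsub>H\<^esub> z))), inv\<^bsub>H\<^esub> x)"
    have "{z \<in> carrier H. fst ?b z \<noteq> \<one>\<^bsub>G\<^esub>} \<subseteq> {z \<in> carrier H. f (x \<otimes>\<^bsub>H\<^esub> z) \<noteq> \<one>\<^bsub>G\<^esub>}"
      by auto
    then have "finite {z \<in> carrier H. fst ?b z \<noteq> \<one>\<^bsub>G\<^esub>}"
      using shift[OF f(2) x] finite_subset by blast
    then have "?b \<in> carrier (wreath G H)"
      using x by (auto simp: wreath_def mem[OF f(1)])
    moreover have "?b \<otimes>\<^bsub>wreath G H\<^esub> a = \<one>\<^bsub>wreath G H\<^esub>"
      using x by (simp add: a wreath_def mem[OF f(1)] H.m_assoc[symmetric] cong: restrict_cong)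
    ultimately show "\<exists>b\<in>carrier (wreath G H). b \<otimes>\<^bsub>wreath G H\<^esub> a = \<one>\<^bsub>wreath G H\<^esub>"
      by blast
  qed
qed

section \<open>Word metrics\<close>

definition symmetric_generating_set :: "('a, 'm) monoid_scheme \<Rightarrow> 'a set \<Rightarrow> bool" where
  "symmetric_generating_set \<Gamma> S \<longleftrightarrow>
     S \<subseteq> carrier \<Gamma> \<and> (\<forall>s\<in>S. inv\<^bsub>\<Gamma>\<^esub> s \<in> S) \<and> generate \<Gamma> S = carrier \<Gamma>"

definition word_length :: "('a, 'm) monoid_scheme \<Rightarrow> 'a set \<Rightarrow> 'a \<Rightarrow> nat" where
  "word_length \<Gamma> S x =
     (LEAST n. \<exists>ws. length ws = n \<and> set ws \<subseteq> S \<union> (\<lambda>s. inv\<^bsub>\<Gamma>\<^esub> s) ` S \<and>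
                    foldr (\<lambda>s y. s \<otimes>\<^bsub>\<Gamma>\<^esub> y) ws \<one>\<^bsub>\<Gamma>\<^esub> = x)"

definition word_dist :: "('a, 'm) monoid_scheme \<Rightarrow> 'a set \<Rightarrow> 'a \<Rightarrow> 'a \<Rightarrow> nat" where
  "word_dist \<Gamma> S x y = word_length \<Gamma> S (inv\<^bsub>\<Gamma>\<^esub> x \<otimes>\<^bsub>\<Gamma>\<^esub> y)"

section \<open>Compression exponents in \<open>L\<^sub>p\<close> of the unit interval\<close>

text \<open>Elements of \<open>L\<^sub>p\<close> are represented by functions rather than by their almost-everywhere classes;
  values outside the unit interval are irrelevant.\<close>

definition Lp_space :: "real \<Rightarrow> (real \<Rightarrow> real) set" where
  "Lp_space p = {\<phi> \<in> borel_measurable (lebesgue_on {0..1}).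
     integrable (lebesgue_on {0..1}) (\<lambda>t. \<bar>\<phi> t\<bar> powr p)}"

definition Lp_norm :: "real \<Rightarrow> (real \<Rightarrow> real) \<Rightarrow> real" where
  "Lp_norm p \<phi> = (integral\<^sup>L (lebesgue_on {0..1}) (\<lambda>t. \<bar>\<phi> t\<bar> powr p)) powr (1 / p)"

definition Lp_embeds_with_exponent ::
  "real \<Rightarrow> ('a, 'm) monoid_scheme \<Rightarrow> 'a set \<Rightarrow> real \<Rightarrow> bool"
where
  "Lp_embeds_with_exponent p \<Gamma> S \<alpha> \<longleftrightarrow>
     (\<exists>f L c. f \<in> carrier \<Gamma> \<rightarrow> Lp_space p \<and> c > 0 \<and>
        (\<forall>x\<in>carrier \<Gamma>. \<forall>y\<in>carrier \<Gamma>.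
           Lp_norm p (\<lambda>t. f x t - f y t) \<le> L * real (word_dist \<Gamma> S x y)) \<and>
        (\<forall>x\<in>carrier \<Gamma>. \<forall>y\<in>carrier \<Gamma>. x \<noteq> y \<longrightarrow>
           Lp_norm p (\<lambda>t. f x t - f y t) \<ge> c * real (word_dist \<Gamma> S x y) powr \<alpha>))"

text \<open>The real supremum is the intended one as soon as \<open>\<Gamma>\<close> is countable and of infinite diameter: the
  set then contains 0 (map \<open>\<Gamma>\<close> to normalized, disjointly supported functions), and it is bounded by
  1 since the Lipschitz bound excludes larger exponents.\<close>

definition compression_exponent :: "real \<Rightarrow> ('a, 'm) monoid_scheme \<Rightarrow> 'a set \<Rightarrow> real" where
  "compression_exponent p \<Gamma> S = Sup {\<alpha>. \<alpha> \<ge> 0 \<and> Lp_embeds_with_exponent p \<Gamma> S \<alpha>}"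

end

theory Submission
  imports Defs
begin

text \<open>
  Let \<open>N\<close> be the distance of two elements \<open>(f, x)\<close> and \<open>(g, y)\<close> in the lamplighter metric and \<open>D\<close> the sum
  of the distances in \<open>G\<close> between \<open>f z\<close> and \<open>g z\<close>. A lamplighter word describes a tour through all sites
  at which the lamps differ; setting each lamp once along this tour, by a word in the generators of \<open>G\<close>,
  shows that their distance in the wreath product is comparable with \<open>N + D\<close>, and that at most \<open>N\<close> lamps
  differ (\<open>tour_bound\<close>, \<open>word_dist_comparison\<close>).

  Given Lipschitz maps \<open>\<psi>\<close> of \<open>G\<close> with exponent \<open>a\<close> and \<open>\<phi>\<close> of the lamplighter group with exponent \<open>b\<close>, let
  \<open>F (f, x)\<close> be the vector with components \<open>\<phi> (f, x)\<close> and \<open>\<psi> (f z)\<close> for all \<open>z\<close>, in an \<open>\<ell>\<^sub>p\<close> direct sum of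
  copies of \<open>L\<^sub>p\<close>. Scaling the copies into disjoint subintervals puts this sum back into \<open>L\<^sub>p\<close> of the unit
  interval (\<open>Lp_direct_sum\<close>). The map \<open>F\<close> is Lipschitz, and the \<open>p\<close>-th power of the distance of two images
  is at least a constant times \<open>N powr (p * b)\<close> plus the sum of \<open>d powr (p * a)\<close> over the distances \<open>d\<close>
  between the lamps that differ (\<open>wreath_Lp_embeds\<close>).

  It remains to bound this expression below by a power of \<open>N + D\<close> (\<open>max_powr_wreath_exponent_le\<close>). If
  \<open>p * a > 1\<close>, the sum is smallest when the mass \<open>D\<close> is spread over as many lamps as possible, that is
  over \<open>N\<close> of them, where it is \<open>N powr (1 - p * a) * D powr (p * a)\<close>. This decreases in \<open>N\<close> and
  \<open>N powr (p * b)\<close> increases; if also \<open>p * b > 1\<close>, they are balanced at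
  \<open>N = D powr (p * a / (p * a + p * b - 1))\<close>, and the common value there is the \<open>p\<close>-th power of \<open>D\<close> to the
  exponent in the first claim, with \<open>a\<close> and \<open>b\<close> in place of the two suprema. If \<open>p * a \<le> 1\<close> or \<open>p * b \<le> 1\<close>, no spreading can bring the expression below
  the \<open>p\<close>-th power of \<open>N + D\<close> to the exponent \<open>min a b\<close>, up to constants.

  Finally \<open>a\<close> and \<open>b\<close> tend to the two compression exponents (\<open>wreath_exponent_limit_le\<close>). These are suprema
  of nonempty sets bounded by 1, because the groups are countable and unbounded.
\<close>

section \<open>Power sums and the exponent of a wreath product\<close>

text \<open>The second value is the exponent \<open>\<theta>\<close> for which \<open>D powr (p * \<theta>)\<close> is the common value of
  \<open>N powr (p * b)\<close> and \<open>N powr (1 - p * a) * D powr (p * a)\<close> at the \<open>N\<close> where these two agree.\<close>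

definition wreath_exponent :: "real \<Rightarrow> real \<Rightarrow> real \<Rightarrow> real" where
  "wreath_exponent p a b =
     (if p * a \<le> 1 \<or> p * b \<le> 1 then min a b else p * a * b / (p * a + p * b - 1))"

lemma wreath_exponent_nonneg:
  assumes "1 \<le> p" "0 \<le> a" "0 \<le> b"
  shows "0 \<le> wreath_exponent p a b"
  using assms by (auto simp: wreath_exponent_def)

lemma wreath_exponent_le:
  assumes "1 \<le> p" "0 \<le> a" "0 \<le> b"
  shows "wreath_exponent p a b \<le> b"
proof (cases "p * a \<le> 1 \<or> p * b \<le> 1")
  case False
  have "0 \<le> b * (p * b - 1)"
    using False assms by (intro mult_nonneg_nonneg) auto
  then have "p * a * b \<le> b * (p * a + p * b - 1)"
    by (simp add: algebra_simps)
  then show ?thesis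
    using False by (simp add: wreath_exponent_def pos_divide_le_eq)
qed (auto simp: wreath_exponent_def)

lemma powr_sum_le_sum_powr:
  fixes d :: "'a \<Rightarrow> real"
  assumes "finite I" and "\<And>i. i \<in> I \<Longrightarrow> 0 \<le> d i" and "0 \<le> q" "q \<le> 1"
  shows "(\<Sum>i\<in>I. d i) powr q \<le> (\<Sum>i\<in>I. d i powr q)"
proof (cases "(\<Sum>i\<in>I. d i) = 0")
  case False
  define D where "D = (\<Sum>i\<in>I. d i)"
  have D: "D > 0"
    using False assms(2) by (simp add: D_def sum_nonneg order_less_le)
  have "1 = (\<Sum>i\<in>I. d i / D)"
    using D by (simp add: D_def sum_divide_distrib[symmetric])
  also have "\<dots> \<le> (\<Sum>i\<in>I. (d i / D) powr q)"
  proof (rule sum_mono)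
    fix i assume i: "i \<in> I"
    have "d i \<le> D"
      unfolding D_def using assms i by (intro member_le_sum) auto
    then have "d i / D \<le> 1" "0 \<le> d i / D"
      using D assms(2)[OF i] by auto
    then show "d i / D \<le> (d i / D) powr q"
      using powr_mono'[of q 1 "d i / D"] assms(4) assms(2)[OF i] D by (cases "d i = 0") simp_all
  qed
  also have "\<dots> = (\<Sum>i\<in>I. d i powr q) / D powr q"
    using D assms(2) by (simp add: powr_divide sum_divide_distrib)
  finally show ?thesis
    using D by (simp add: D_def[symmetric] pos_le_divide_eq)
qed (simp add: assms sum_nonneg)

lemma sum_powr_le_powr_sum:
  fixes d :: "'a \<Rightarrow> real"
  assumes "finite I" and d: "\<And>i. i \<in> I \<Longrightarrow> 0 \<le> d i" and p: "1 \<le> p"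
  shows "(\<Sum>i\<in>I. d i powr p) \<le> (\<Sum>i\<in>I. d i) powr p"
proof -
  have "(\<Sum>i\<in>I. d i powr p) powr (1 / p) \<le> (\<Sum>i\<in>I. (d i powr p) powr (1 / p))"
    using assms by (intro powr_sum_le_sum_powr) auto
  also have "\<dots> = (\<Sum>i\<in>I. d i)"
    using d p by (simp add: powr_powr)
  finally have "((\<Sum>i\<in>I. d i powr p) powr (1 / p)) powr p \<le> (\<Sum>i\<in>I. d i) powr p"
    using p by (intro powr_mono2) auto
  then show ?thesis
    using p by (simp add: powr_powr sum_nonneg)
qed

text \<open>Jensen's inequality for \<open>x powr q\<close>. As \<open>1 - q \<le> 0\<close>, the bound is weakest when the mass is spread over many summands.\<close>

lemma powr_sum_le_card_powr_sum_powr: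
  fixes d :: "'a \<Rightarrow> real"
  assumes "finite I" "I \<noteq> {}" and "\<And>i. i \<in> I \<Longrightarrow> 0 < d i" and "1 \<le> q"
  shows "real (card I) powr (1 - q) * (\<Sum>i\<in>I. d i) powr q \<le> (\<Sum>i\<in>I. d i powr q)"
proof -
  let ?k = "real (card I)"
  have k: "?k > 0"
    using assms by (simp add: card_gt_0_iff)
  have D: "(\<Sum>i\<in>I. d i) > 0"
    using assms by (intro sum_pos) auto
  have "(\<Sum>i\<in>I. (1 / ?k) *\<^sub>R d i) powr q \<le> (\<Sum>i\<in>I. (1 / ?k) * d i powr q)"
    using assms k by (intro convex_on_sum[OF _ _ powr_convex]) auto
  then have "((\<Sum>i\<in>I. d i) / ?k) powr q \<le> (\<Sum>i\<in>I. d i powr q) / ?k"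
    by (simp add: sum_divide_distrib)
  then have "?k * ((\<Sum>i\<in>I. d i) powr q / ?k powr q) \<le> (\<Sum>i\<in>I. d i powr q)"
    using k D by (simp add: powr_divide pos_le_divide_eq mult.commute)
  then show ?thesis
    using k by (simp add: powr_diff)
qed

text \<open>In the application the \<open>d i\<close> are the distances in \<open>G\<close> between the lamps that differ, and \<open>N\<close> is the
  lamplighter distance, which is at least the number of these lamps. If \<open>N\<close> dominates the sum \<open>D\<close>,
  the first summand on the right suffices, as the exponent is at most \<open>b\<close>. Otherwise, if one of
  \<open>p * a\<close>, \<open>p * b\<close> is at most 1, subadditivity of \<open>x powr (p * a)\<close>, or \<open>d i \<ge> 1\<close>, bounds the sum of
  powers below by a power of \<open>D\<close>. If both exceed 1, Jensen's inequality with at most \<open>N\<close> summands gives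
  \<open>N powr (1 - p * a) * D powr (p * a)\<close>, which decreases in \<open>N\<close> while \<open>N powr (p * b)\<close> increases.\<close>

lemma max_powr_wreath_exponent_le:
  fixes d :: "'a \<Rightarrow> real"
  assumes "finite I" and d: "\<And>i. i \<in> I \<Longrightarrow> 1 \<le> d i"
    and N: "real (card I) \<le> N" "1 \<le> N" and p: "1 \<le> p" and ab: "0 \<le> a" "0 \<le> b"
  shows "max N (\<Sum>i\<in>I. d i) powr (p * wreath_exponent p a b)
    \<le> N powr (p * b) + (\<Sum>i\<in>I. d i powr (p * a))"
proof -
  define D where "D = (\<Sum>i\<in>I. d i)"
  define E where "E = (\<Sum>i\<in>I. d i powr (p * a))"
  have E0: "0 \<le> E"
    by (simp add: E_def sum_nonneg)
  define \<theta> where "\<theta> = wreath_exponent p a b"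
  have \<theta>: "p * \<theta> \<le> p * b"
    using wreath_exponent_le p ab by (simp add: \<theta>_def)
  show ?thesis
  proof (cases "D \<le> N")
    case True
    then have "max N D powr (p * \<theta>) \<le> N powr (p * b)"
      using N \<theta> by (simp add: max_def powr_mono)
    then show ?thesis
      using E0 by (simp add: E_def[symmetric] D_def[symmetric] \<theta>_def[symmetric])
  next
    case False
    then have DN: "N < D"
      by simp
    then have D1: "1 < D"
      using N by simp
    have I: "I \<noteq> {}"
      using D1 by (auto simp: D_def)
    have "D powr (p * \<theta>) \<le> N powr (p * b) + E"
    proof (cases "p * a \<le> 1 \<or> p * b \<le> 1")
      case True
      then have \<theta>min: "\<theta> = min a b"
        by (simp add: \<theta>_def wreath_exponent_def)
      have "D powr (p * \<theta>) \<le> E"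
      proof (cases "p * a \<le> 1")
        case True
        have "p * \<theta> \<le> p * a"
          using \<theta>min p by simp
        then have "D powr (p * \<theta>) \<le> D powr (p * a)"
          using D1 by (intro powr_mono) auto
        also have "\<dots> \<le> E"
          unfolding D_def E_def
          using True ab p by (intro powr_sum_le_sum_powr assms order_trans[OF zero_le_one d]) auto
        finally show ?thesis .
      next
        case False
        then have "p * b \<le> 1"
          using True by simp
        then have "D powr (p * \<theta>) \<le> D powr 1"
          using D1 \<theta> by (intro powr_mono) auto
        also have "\<dots> = D"
          using D1 by simp
        also have "\<dots> \<le> E"
          unfolding D_def E_def
        proof (rule sum_mono)
          fix i assume "i \<in> I"
          then show "d i \<le> d i powr (p * a)"
            using powr_mono[of 1 "p * a" "d i"] d[of i] False by simp
        qed
        finally show ?thesis .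
      qed
      then show ?thesis
        using powr_ge_zero[of N "p * b"] by linarith
    next
      case False
      define m where "m = p * a + p * b - 1"
      have m: "m > 0"
        using False by (simp add: m_def)
      have \<theta>m: "p * \<theta> = p * a * (p * b) / m"
        using False by (simp add: \<theta>_def wreath_exponent_def m_def)
      \<comment> \<open>The threshold is the value of \<open>N\<close> at which the increasing and the decreasing bound agree.\<close>
      show ?thesis
      proof (cases "D powr (p * a / m) \<le> N")
        case True
        have "D powr (p * \<theta>) = (D powr (p * a / m)) powr (p * b)"
          by (simp add: powr_powr \<theta>m)
        also have "\<dots> \<le> N powr (p * b)"
          using True p ab by (intro powr_mono2) auto
        finally show ?thesis
          using E0 by simp
      next
        case f: False
        have k: "real (card I) > 0"
          using I assms(1) by (simp add: card_gt_0_iff)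
        have "p * \<theta> = p * a / m * (1 - p * a) + p * a"
          using m unfolding \<theta>m by (simp add: field_simps) (simp add: m_def algebra_simps)
        then have "D powr (p * \<theta>) = (D powr (p * a / m)) powr (1 - p * a) * D powr (p * a)"
          by (simp add: powr_powr powr_add[symmetric])
        also have "\<dots> \<le> real (card I) powr (1 - p * a) * D powr (p * a)"
          using f k N False by (intro mult_right_mono powr_mono2') auto
        also have "\<dots> \<le> E"
          unfolding D_def E_def using assms(1) I False
          by (intro powr_sum_le_card_powr_sum_powr less_le_trans[OF zero_less_one d]) auto
        finally show ?thesis
          using powr_ge_zero[of N "p * b"] by linarith
      qed
    qed
    then show ?thesis
      using DN by (simp add: E_def[symmetric] D_def[symmetric] \<theta>_def[symmetric] max_def)
  qed
qed

section \<open>Finite direct sums inside \<open>L\<^sub>p\<close> of the unit interval\<close>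

text \<open>The \<open>p\<close>-th power of the norm is additive over functions with disjoint supports; all estimates are
  made for this quantity, and the root is only taken when an embedding is stated.\<close>

definition Lp_energy :: "real \<Rightarrow> (real \<Rightarrow> real) \<Rightarrow> real" where
  "Lp_energy p \<phi> = integral\<^sup>L (lebesgue_on {0..1}) (\<lambda>t. \<bar>\<phi> t\<bar> powr p)"

lemma Lp_energy_nonneg: "0 \<le> Lp_energy p \<phi>"
  by (simp add: Lp_energy_def integral_nonneg_AE)

lemma Lp_norm_eq_energy: "Lp_norm p \<phi> = Lp_energy p \<phi> powr (1 / p)"
  by (simp add: Lp_norm_def Lp_energy_def)

lemma Lp_norm_powr: "0 < p \<Longrightarrow> Lp_norm p \<phi> powr p = Lp_energy p \<phi>"
  using Lp_energy_nonneg[of p \<phi>] by (simp add: Lp_norm_eq_energy powr_powr)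

lemma abs_diff_powr_le:
  fixes x y :: real
  assumes "0 \<le> p"
  shows "\<bar>x - y\<bar> powr p \<le> 2 powr p * (\<bar>x\<bar> powr p + \<bar>y\<bar> powr p)"
proof -
  have "\<bar>x - y\<bar> powr p \<le> (2 * max \<bar>x\<bar> \<bar>y\<bar>) powr p"
    using assms by (intro powr_mono2) auto
  also have "\<dots> = 2 powr p * max \<bar>x\<bar> \<bar>y\<bar> powr p"
    by (simp add: powr_mult)
  also have "\<dots> \<le> 2 powr p * (\<bar>x\<bar> powr p + \<bar>y\<bar> powr p)"
    by (intro mult_left_mono) (auto simp: max_def)
  finally show ?thesis .
qed

lemma Lp_space_diff:
  assumes "0 \<le> p" "\<phi> \<in> Lp_space p" "\<psi> \<in> Lp_space p"
  shows "(\<lambda>t. \<phi> t - \<psi> t) \<in> Lp_space p"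
proof -
  have [measurable]: "\<phi> \<in> borel_measurable (lebesgue_on {0..1})"
      "\<psi> \<in> borel_measurable (lebesgue_on {0..1})"
    using assms by (auto simp: Lp_space_def)
  have "integrable (lebesgue_on {0..1}) (\<lambda>t. \<bar>\<phi> t - \<psi> t\<bar> powr p)"
  proof (rule Bochner_Integration.integrable_bound)
    show "integrable (lebesgue_on {0..1}) (\<lambda>t. 2 powr p * (\<bar>\<phi> t\<bar> powr p + \<bar>\<psi> t\<bar> powr p))"
      using assms by (auto simp: Lp_space_def)
    show "AE t in lebesgue_on {0..1}. norm (\<bar>\<phi> t - \<psi> t\<bar> powr p)
        \<le> norm (2 powr p * (\<bar>\<phi> t\<bar> powr p + \<bar>\<psi> t\<bar> powr p))"
      using abs_diff_powr_le[OF assms(1)] by (auto simp: abs_of_nonneg)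
  qed measurable
  then show ?thesis
    by (simp add: Lp_space_def)
qed

lemma Lp_space_const: "(\<lambda>t. c) \<in> Lp_space p"
  by (simp add: Lp_space_def)

lemma Lp_energy_const: "Lp_energy p (\<lambda>t. c) = \<bar>c\<bar> powr p"
  by (simp add: Lp_energy_def measure_restrict_space)

text \<open>The blocks are the intervals from \<open>1 / 3 ^ Suc n\<close> to \<open>2 / 3 ^ Suc n\<close>, described by the affine map
  that takes them to the unit interval. The ratio 3 leaves gaps between them, which makes the
  closed intervals disjoint.\<close>

definition in_block :: "nat \<Rightarrow> real \<Rightarrow> bool" where
  "in_block n t \<longleftrightarrow> 3 ^ Suc n * t - 1 \<in> {0..1}"

lemma in_block_unique:
  assumes "in_block n t" "in_block m t"
  shows "n = m"
proof -
  have *: False if "in_block i t" "in_block j t" "i < j" for i j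
  proof -
    have "(3::real) ^ Suc i * 3 \<le> 3 ^ Suc j"
      using that(3) power_increasing[of "Suc (Suc i)" "Suc j" "3::real"] by (simp add: mult.commute)
    moreover have t: "1 \<le> 3 ^ Suc i * t" "3 ^ Suc j * t \<le> 2"
      using that by (auto simp: in_block_def)
    moreover have "t > 0"
    proof (rule ccontr)
      assume "\<not> t > 0"
      then have "3 ^ Suc i * t \<le> 0"
        by (intro mult_nonneg_nonpos) auto
      then show False
        using t by linarith
    qed
    ultimately have "(3 ^ Suc i * 3) * t \<le> 3 ^ Suc j * t"
      by (intro mult_right_mono) auto
    then show False
      using t by (simp add: mult.commute mult.left_commute)
  qed
  show ?thesis
    using *[of n m] *[of m n] assms by (cases n m rule: linorder_cases) auto
qed

lemma in_block_imp_unit: "in_block n t \<Longrightarrow> t \<in> {0..1}"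
proof -
  assume "in_block n t"
  then have t: "1 \<le> 3 ^ Suc n * t" "3 ^ Suc n * t \<le> 2"
    by (auto simp: in_block_def)
  have k: "(3::real) \<le> 3 ^ Suc n"
    using power_increasing[of 1 "Suc n" "3::real"] by simp
  have "t \<ge> 0"
    using t(1) k zero_le_mult_iff[of "3 ^ Suc n" t] by linarith
  moreover have "3 * t \<le> 3 ^ Suc n * t"
    using k \<open>t \<ge> 0\<close> by (rule mult_right_mono)
  ultimately show "t \<in> {0..1}"
    using t by auto
qed

definition block :: "real \<Rightarrow> nat \<Rightarrow> (real \<Rightarrow> real) \<Rightarrow> real \<Rightarrow> real" where
  "block p n \<phi> t =
     (if in_block n t then (3 ^ Suc n) powr (1 / p) * \<phi> (3 ^ Suc n * t - 1) else 0)"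

text \<open>The factor in front of \<open>\<phi>\<close> compensates the Jacobian \<open>3 ^ Suc n\<close> of the affine substitution.\<close>

lemma block_isometric:
  assumes p: "0 < p" and \<phi>: "\<phi> \<in> Lp_space p"
  shows "block p n \<phi> \<in> Lp_space p" "Lp_energy p (block p n \<phi>) = Lp_energy p \<phi>"
proof -
  define k :: real where "k = 3 ^ Suc n"
  have k: "k > 0"
    by (simp add: k_def)
  define g where "g = (\<lambda>s. indicator {0..1} s * \<phi> s)"
  define h where "h = (\<lambda>s. indicator {0..1} s * \<bar>\<phi> s\<bar> powr p)"
  have g: "g \<in> borel_measurable lebesgue"
    using \<phi> borel_measurable_restrict_space_iff[of "{0..1}" lebesgue \<phi>]
    by (simp add: Lp_space_def g_def)
  have h: "integrable lebesgue h"
    using \<phi> integrable_restrict_space[of "{0..1}" lebesgue "\<lambda>t. \<bar>\<phi> t\<bar> powr p"]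
    by (simp add: Lp_space_def h_def)
  have hint: "integral\<^sup>L lebesgue h = Lp_energy p \<phi>"
    using integral_restrict_space[of "{0..1}" lebesgue "\<lambda>t. \<bar>\<phi> t\<bar> powr p"]
    by (simp add: Lp_energy_def h_def)
  have block_eq: "block p n \<phi> t = k powr (1 / p) * g (- 1 + k * t)" for t
    by (simp add: block_def in_block_def g_def k_def indicator_def)
  have aff: "(\<lambda>t. - 1 + k * t) \<in> lebesgue \<rightarrow>\<^sub>M lebesgue"
    using lebesgue_affine_measurable[of "\<lambda>x::real. k" "-1"] k by simp
  have "block p n \<phi> \<in> borel_measurable lebesgue"
    unfolding block_eq[abs_def] using measurable_compose[OF aff g] by simp
  then have meas: "block p n \<phi> \<in> borel_measurable (lebesgue_on {0..1})"
    by (rule measurable_restrict_space1)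
  \<comment> \<open>The block lies inside the unit interval, so restricting to the latter loses nothing.\<close>
  have pow: "indicator {0..1} t * \<bar>block p n \<phi> t\<bar> powr p = k * h (- 1 + k * t)" for t
  proof (cases "in_block n t")
    case True
    then show ?thesis
      using in_block_imp_unit[OF True] k p
      by (simp add: block_def h_def k_def in_block_def abs_mult powr_mult powr_powr)
  next
    case False
    then have "- 1 + k * t \<notin> {0..1}"
      by (simp add: in_block_def k_def)
    then show ?thesis
      using False by (simp only: block_def h_def indicator_def) simp
  qed
  have int: "integrable lebesgue (\<lambda>t. k * h (- 1 + k * t))"
    using lebesgue_integrable_real_affine[OF h, of k "- 1"] k by simp
  then show "block p n \<phi> \<in> Lp_space p"
    using meas integrable_restrict_space[of "{0..1}" lebesgue "\<lambda>t. \<bar>block p n \<phi> t\<bar> powr p"]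
    by (simp add: Lp_space_def pow)
  have "Lp_energy p (block p n \<phi>) = integral\<^sup>L lebesgue (\<lambda>t. k * h (- 1 + k * t))"
    using integral_restrict_space[of "{0..1}" lebesgue "\<lambda>t. \<bar>block p n \<phi> t\<bar> powr p"]
    by (simp add: Lp_energy_def pow)
  also have "\<dots> = integral\<^sup>L lebesgue h"
    using lebesgue_integral_real_affine[of k h "- 1"] k by simp
  finally show "Lp_energy p (block p n \<phi>) = Lp_energy p \<phi>"
    by (simp add: hint)
qed

text \<open>The \<open>\<ell>\<^sub>p\<close> direct sum of a sequence of functions, realised on the unit interval itself. Each point
  lies in at most one block, so the choice of the block is unambiguous.\<close>

definition glue :: "real \<Rightarrow> (nat \<Rightarrow> real \<Rightarrow> real) \<Rightarrow> real \<Rightarrow> real" where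
  "glue p \<phi> t = (if \<exists>n. in_block n t then block p (THE n. in_block n t) (\<phi> (THE n. in_block n t)) t else 0)"

lemma glue_in_block: "in_block n t \<Longrightarrow> glue p \<phi> t = block p n (\<phi> n) t"
proof -
  assume n: "in_block n t"
  have "(THE n. in_block n t) = n"
    using n in_block_unique[OF _ n] by (rule the_equality)
  then show ?thesis
    using n by (auto simp: glue_def)
qed

lemma glue_diff: "glue p \<phi> t - glue p \<psi> t = glue p (\<lambda>n s. \<phi> n s - \<psi> n s) t"
proof (cases "\<exists>n. in_block n t")
  case True
  then obtain n where "in_block n t" ..
  then show ?thesis
    by (simp add: glue_in_block block_def right_diff_distrib)
qed (simp add: glue_def)

lemma glue_isometric:
  assumes p: "0 < p" and "finite A"
    and \<phi>: "\<And>n. n \<in> A \<Longrightarrow> \<phi> n \<in> Lp_space p" and z: "\<And>n. n \<notin> A \<Longrightarrow> \<phi> n = (\<lambda>t. 0)"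
  shows "glue p \<phi> \<in> Lp_space p" "Lp_energy p (glue p \<phi>) = (\<Sum>n\<in>A. Lp_energy p (\<phi> n))"
proof -
  have sum_if: "glue p \<phi> t = (\<Sum>n\<in>A. block p n (\<phi> n) t)"
    "\<bar>glue p \<phi> t\<bar> powr p = (\<Sum>n\<in>A. \<bar>block p n (\<phi> n) t\<bar> powr p)" for t
  proof -
    have "glue p \<phi> t = (\<Sum>n\<in>A. block p n (\<phi> n) t) \<and>
      \<bar>glue p \<phi> t\<bar> powr p = (\<Sum>n\<in>A. \<bar>block p n (\<phi> n) t\<bar> powr p)"
    proof (cases "\<exists>n. in_block n t")
      case True
      then obtain n where n: "in_block n t" ..
      have 0: "block p m (\<phi> m) t = 0" if "m \<noteq> n" for m
        using that n in_block_unique[of n t m] by (auto simp: block_def)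
      show ?thesis
      proof (cases "n \<in> A")
        case True
        have s: "sum f A = f n + sum f (A - {n})" for f :: "nat \<Rightarrow> real"
          using \<open>finite A\<close> True by (simp add: sum.remove)
        show ?thesis
          using 0 by (simp add: s glue_in_block[OF n])
      next
        case False
        then have "\<forall>m\<in>A. m \<noteq> n" by auto
        moreover have "glue p \<phi> t = 0"
          using z[OF False] by (simp add: glue_in_block[OF n] block_def)
        ultimately show ?thesis
          using 0 by simp
      qed
    next
      case False
      then show ?thesis
        by (simp add: glue_def block_def)
    qed
    then show "glue p \<phi> t = (\<Sum>n\<in>A. block p n (\<phi> n) t)"
      "\<bar>glue p \<phi> t\<bar> powr p = (\<Sum>n\<in>A. \<bar>block p n (\<phi> n) t\<bar> powr p)"
      by auto
  qed
  have B: "block p n (\<phi> n) \<in> Lp_space p" "Lp_energy p (block p n (\<phi> n)) = Lp_energy p (\<phi> n)"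
    if "n \<in> A" for n
    using block_isometric[OF p \<phi>[OF that]] by auto
  have "glue p \<phi> \<in> borel_measurable (lebesgue_on {0..1})"
    unfolding sum_if(1)[abs_def] using B by (intro borel_measurable_sum) (auto simp: Lp_space_def)
  moreover have "integrable (lebesgue_on {0..1}) (\<lambda>t. \<bar>glue p \<phi> t\<bar> powr p)"
    unfolding sum_if(2) using B by (intro Bochner_Integration.integrable_sum) (auto simp: Lp_space_def)
  ultimately show "glue p \<phi> \<in> Lp_space p"
    by (simp add: Lp_space_def)
  have "Lp_energy p (glue p \<phi>) = (\<Sum>n\<in>A. Lp_energy p (block p n (\<phi> n)))"
    unfolding Lp_energy_def sum_if(2) using B
    by (intro Bochner_Integration.integral_sum) (auto simp: Lp_space_def)
  then show "Lp_energy p (glue p \<phi>) = (\<Sum>n\<in>A. Lp_energy p (\<phi> n))"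
    using B(2) by simp
qed

section \<open>Word lengths\<close>

locale generated_group = group \<Gamma> for \<Gamma> :: "('a, 'm) monoid_scheme" (structure) +
  fixes S :: "'a set"
  assumes gens_closed: "S \<subseteq> carrier \<Gamma>" and generate_gens: "generate \<Gamma> S = carrier \<Gamma>"
begin

abbreviation letters :: "'a set" where
  "letters \<equiv> S \<union> (\<lambda>s. inv s) ` S"

abbreviation word_prod :: "'a list \<Rightarrow> 'a" where
  "word_prod ws \<equiv> foldr (\<lambda>s y. s \<otimes> y) ws \<one>"

abbreviation len :: "'a \<Rightarrow> nat" where
  "len \<equiv> word_length \<Gamma> S"

lemma letters_closed: "s \<in> letters \<Longrightarrow> s \<in> carrier \<Gamma>"
  using gens_closed by auto

lemma word_prod_closed: "set ws \<subseteq> letters \<Longrightarrow> word_prod ws \<in> carrier \<Gamma>"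
  using letters_closed by (induction ws) auto

lemma word_prod_append:
  "set us \<subseteq> letters \<Longrightarrow> set vs \<subseteq> letters \<Longrightarrow> word_prod (us @ vs) = word_prod us \<otimes> word_prod vs"
proof (induction us)
  case Nil
  then show ?case
    using word_prod_closed[of vs] by simp
next
  case (Cons s us)
  then show ?case
    using word_prod_closed[of us] word_prod_closed[of vs] letters_closed[of s] by (simp add: m_assoc)
qed

lemma word_exists:
  assumes "x \<in> carrier \<Gamma>"
  shows "\<exists>ws. set ws \<subseteq> letters \<and> word_prod ws = x"
proof -
  have "x \<in> generate \<Gamma> S"
    using assms generate_gens by simp
  then show ?thesis
  proof (induction rule: generate.induct)
    case one
    show ?case by (rule exI[of _ "[]"]) simp
  next
    case (incl h)
    then show ?case
      using letters_closed[of h] by (intro exI[of _ "[h]"]) auto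
  next
    case (inv h)
    then show ?case
      using letters_closed[of "inv h"] by (intro exI[of _ "[inv h]"]) auto
  next
    case (eng h1 h2)
    then obtain us vs where "set us \<subseteq> letters" "word_prod us = h1" "set vs \<subseteq> letters" "word_prod vs = h2"
      by blast
    then show ?case
      by (intro exI[of _ "us @ vs"] conjI) (simp, simp only: word_prod_append)
  qed
qed

lemma geodesic_word_exists:
  assumes "x \<in> carrier \<Gamma>"
  shows "\<exists>ws. length ws = len x \<and> set ws \<subseteq> letters \<and> word_prod ws = x"
proof -
  obtain ws where "set ws \<subseteq> letters" "word_prod ws = x"
    using word_exists[OF assms] by auto
  then have "\<exists>us. length us = length ws \<and> set us \<subseteq> letters \<and> word_prod us = x"
    by (intro exI[of _ ws]) simp
  then show ?thesis
    unfolding word_length_def by (rule LeastI)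
qed

lemma len_word_prod_le: "set ws \<subseteq> letters \<Longrightarrow> len (word_prod ws) \<le> length ws"
  unfolding word_length_def by (intro Least_le exI[of _ ws]) simp

lemma len_one: "len \<one> = 0"
  using len_word_prod_le[of "[]"] by simp

lemma len_eq_0_imp: "x \<in> carrier \<Gamma> \<Longrightarrow> len x = 0 \<Longrightarrow> x = \<one>"
  using geodesic_word_exists[of x] by (metis foldr_Nil id_apply length_0_conv)

lemma len_mult_le:
  assumes "x \<in> carrier \<Gamma>" "y \<in> carrier \<Gamma>"
  shows "len (x \<otimes> y) \<le> len x + len y"
proof -
  obtain us vs where "length us = len x" "set us \<subseteq> letters" "word_prod us = x"
      "length vs = len y" "set vs \<subseteq> letters" "word_prod vs = y"
    using geodesic_word_exists assms by meson
  then show ?thesis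
    using len_word_prod_le[of "us @ vs"] word_prod_append[of us vs] by simp
qed

lemma word_dist_ge_1:
  assumes "x \<in> carrier \<Gamma>" "y \<in> carrier \<Gamma>" "x \<noteq> y"
  shows "1 \<le> word_dist \<Gamma> S x y"
proof (rule ccontr)
  assume "\<not> 1 \<le> word_dist \<Gamma> S x y"
  then have "inv x \<otimes> y = \<one>"
    using assms len_eq_0_imp[of "inv x \<otimes> y"] by (simp add: word_dist_def)
  then have "x = y"
    using assms inv_solve_left[of \<one> x y] by (simp add: r_one)
  then show False
    using assms by simp
qed

text \<open>Cut a shortest word into its letters. With the length for another generating set as \<open>\<mu>\<close>, this reduces
  the comparison of two word metrics on one group to a bound on the letters.\<close>

lemma subadditive_le_len:
  fixes \<mu> :: "'a \<Rightarrow> real"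
  assumes "\<mu> \<one> \<le> 0"
    and "\<And>x y. x \<in> carrier \<Gamma> \<Longrightarrow> y \<in> carrier \<Gamma> \<Longrightarrow> \<mu> (x \<otimes> y) \<le> \<mu> x + \<mu> y"
    and "\<And>s. s \<in> letters \<Longrightarrow> \<mu> s \<le> C"
    and "x \<in> carrier \<Gamma>"
  shows "\<mu> x \<le> C * real (len x)"
proof -
  have "\<mu> (word_prod ws) \<le> C * real (length ws)" if "set ws \<subseteq> letters" for ws
    using that
  proof (induction ws)
    case (Cons s ws)
    have "\<mu> (word_prod (s # ws)) \<le> \<mu> s + \<mu> (word_prod ws)"
      using Cons.prems word_prod_closed[of ws] letters_closed[of s] assms(2) by simp
    also have "\<dots> \<le> C + C * real (length ws)"
      using Cons assms(3)[of s] by auto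
    finally show ?case
      by (simp add: algebra_simps)
  qed (use assms(1) in simp)
  then show ?thesis
    using geodesic_word_exists[OF assms(4)] by metis
qed

lemma countable_carrier:
  assumes "finite S"
  shows "countable (carrier \<Gamma>)"
proof (rule countable_subset)
  show "carrier \<Gamma> \<subseteq> word_prod ` lists letters"
    using word_exists by (force simp: in_lists_conv_set)
  show "countable (word_prod ` lists letters)"
    using assms by (intro countable_image countable_lists countable_finite) simp
qed

lemma len_unbounded:
  assumes "finite S" "infinite (carrier \<Gamma>)"
  shows "\<exists>x\<in>carrier \<Gamma>. n < len x"
proof (rule ccontr)
  assume "\<not> ?thesis"
  then have "carrier \<Gamma> \<subseteq> word_prod ` {ws. set ws \<subseteq> letters \<and> length ws \<le> n}"
    using geodesic_word_exists by (force simp: not_less)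
  moreover have "finite (word_prod ` {ws. set ws \<subseteq> letters \<and> length ws \<le> n})"
    using assms by (intro finite_imageI finite_lists_length_le) simp
  ultimately show False
    using assms finite_subset by blast
qed

end

lemma symmetric_generating_set_imp_generated_group:
  "group \<Gamma> \<Longrightarrow> symmetric_generating_set \<Gamma> S \<Longrightarrow> generated_group \<Gamma> S"
  by (simp add: generated_group_def generated_group_axioms_def symmetric_generating_set_def)

section \<open>The word metric of a wreath product\<close>

locale wreath_product = G: group G + H: group H
  for G :: "('g, 'm) monoid_scheme" and H :: "('h, 'n) monoid_scheme"
begin

sublocale W: group "wreath G H"
  by (rule group_wreath[OF G.is_group H.is_group])

definition unlit :: "'h \<Rightarrow> 'g" where
  "unlit = (\<lambda>z\<in>carrier H. \<one>\<^bsub>G\<^esub>)"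

definition move :: "'h \<Rightarrow> ('h \<Rightarrow> 'g) \<times> 'h" where
  "move t = (unlit, t)"

definition lamp :: "'g \<Rightarrow> ('h \<Rightarrow> 'g) \<times> 'h" where
  "lamp s = ((\<lambda>z\<in>carrier H. if z = \<one>\<^bsub>H\<^esub> then s else \<one>\<^bsub>G\<^esub>), \<one>\<^bsub>H\<^esub>)"

definition supp :: "('h \<Rightarrow> 'g) \<Rightarrow> 'h set" where
  "supp f = {z \<in> carrier H. f z \<noteq> \<one>\<^bsub>G\<^esub>}"

lemma wreath_gens_eq: "wreath_gens G H A B = move ` B \<union> lamp ` A"
  by (auto simp: wreath_gens_def move_def lamp_def unlit_def)

lemma mem_wreath: "(f, x) \<in> carrier (wreath G H) \<longleftrightarrow>
    f \<in> carrier H \<rightarrow>\<^sub>E carrier G \<and> finite (supp f) \<and> x \<in> carrier H"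
  by (auto simp: wreath_def supp_def)

lemma wreath_mult: "(f, x) \<otimes>\<^bsub>wreath G H\<^esub> (g, y) =
    ((\<lambda>z\<in>carrier H. f z \<otimes>\<^bsub>G\<^esub> g (inv\<^bsub>H\<^esub> x \<otimes>\<^bsub>H\<^esub> z)), x \<otimes>\<^bsub>H\<^esub> y)"
  by (simp add: wreath_def)

lemma wreath_one: "\<one>\<^bsub>wreath G H\<^esub> = move \<one>\<^bsub>H\<^esub>"
  by (simp add: wreath_def move_def unlit_def)

lemma wreath_val: "(f, x) \<in> carrier (wreath G H) \<Longrightarrow> z \<in> carrier H \<Longrightarrow> f z \<in> carrier G"
  by (auto simp: mem_wreath)

lemma wreath_restrict: "(f, x) \<in> carrier (wreath G H) \<Longrightarrow> (\<lambda>z\<in>carrier H. f z) = f"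
  by (auto simp: mem_wreath PiE_def extensional_restrict)

lemma supp_subset: "supp f \<subseteq> carrier H"
  by (auto simp: supp_def)

lemma supp_unlit: "supp unlit = {}"
  by (auto simp: supp_def unlit_def)

lemma supp_empty_imp_unlit:
  assumes "(f, x) \<in> carrier (wreath G H)" "supp f = {}"
  shows "f = unlit"
  using wreath_restrict[OF assms(1)] assms(2)
  by (auto simp: unlit_def supp_def restrict_def fun_eq_iff split: if_splits)

lemma move_closed: "t \<in> carrier H \<Longrightarrow> move t \<in> carrier (wreath G H)"
  by (simp add: move_def mem_wreath supp_unlit) (auto simp: unlit_def)

lemma lamp_closed: "s \<in> carrier G \<Longrightarrow> lamp s \<in> carrier (wreath G H)"
  by (auto simp: lamp_def mem_wreath intro: finite_subset[of _ "{\<one>\<^bsub>H\<^esub>}"] simp: supp_def)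

lemma move_mult:
  assumes "t \<in> carrier H" "(f, x) \<in> carrier (wreath G H)"
  shows "move t \<otimes>\<^bsub>wreath G H\<^esub> (f, x) = ((\<lambda>z\<in>carrier H. f (inv\<^bsub>H\<^esub> t \<otimes>\<^bsub>H\<^esub> z)), t \<otimes>\<^bsub>H\<^esub> x)"
  using assms wreath_val[OF assms(2)] by (simp add: move_def unlit_def wreath_mult cong: restrict_cong)

lemma lamp_mult:
  assumes "s \<in> carrier G" "(f, x) \<in> carrier (wreath G H)"
  shows "lamp s \<otimes>\<^bsub>wreath G H\<^esub> (f, x) =
    ((\<lambda>z\<in>carrier H. if z = \<one>\<^bsub>H\<^esub> then s \<otimes>\<^bsub>G\<^esub> f z else f z), x)"
proof -
  have "x \<in> carrier H"
    using assms(2) by (simp add: mem_wreath)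
  then show ?thesis
    using assms wreath_val[OF assms(2)] by (auto simp: lamp_def wreath_mult intro!: restrict_ext)
qed

lemma move_move: "s \<in> carrier H \<Longrightarrow> t \<in> carrier H \<Longrightarrow> move s \<otimes>\<^bsub>wreath G H\<^esub> move t = move (s \<otimes>\<^bsub>H\<^esub> t)"
  by (auto simp: move_def unlit_def wreath_mult intro!: restrict_ext)

lemma lamp_lamp: "s \<in> carrier G \<Longrightarrow> t \<in> carrier G \<Longrightarrow> lamp s \<otimes>\<^bsub>wreath G H\<^esub> lamp t = lamp (s \<otimes>\<^bsub>G\<^esub> t)"
  by (auto simp: lamp_def wreath_mult intro!: restrict_ext)

lemma lamp_one: "lamp \<one>\<^bsub>G\<^esub> = \<one>\<^bsub>wreath G H\<^esub>"
  by (auto simp: lamp_def wreath_one move_def unlit_def)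

lemma inv_move: "t \<in> carrier H \<Longrightarrow> inv\<^bsub>wreath G H\<^esub> (move t) = move (inv\<^bsub>H\<^esub> t)"
  by (rule W.inv_equality) (simp_all add: move_move wreath_one move_closed)

lemma inv_lamp: "s \<in> carrier G \<Longrightarrow> inv\<^bsub>wreath G H\<^esub> (lamp s) = lamp (inv\<^bsub>G\<^esub> s)"
  by (rule W.inv_equality) (simp_all add: lamp_lamp lamp_one lamp_closed)

definition clear_origin :: "('h \<Rightarrow> 'g) \<Rightarrow> 'h \<Rightarrow> 'g" where
  "clear_origin g = (\<lambda>z\<in>carrier H. if z = \<one>\<^bsub>H\<^esub> then \<one>\<^bsub>G\<^esub> else g z)"

definition translate :: "'h \<Rightarrow> ('h \<Rightarrow> 'g) \<Rightarrow> 'h \<Rightarrow> 'g" where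
  "translate t g = (\<lambda>z\<in>carrier H. g (t \<otimes>\<^bsub>H\<^esub> z))"

lemma supp_clear_origin: "supp (clear_origin g) = supp g - {\<one>\<^bsub>H\<^esub>}"
  by (auto simp: supp_def clear_origin_def)

text \<open>Two ways to peel off one factor from the left: the lamp at the origin can be set first, and the
  lamplighter can first step to \<open>t\<close>, which recentres the configuration.\<close>

lemma lamp_factor:
  assumes "(g, x) \<in> carrier (wreath G H)"
  shows "(clear_origin g, x) \<in> carrier (wreath G H)"
    and "(g, x) = lamp (g \<one>\<^bsub>H\<^esub>) \<otimes>\<^bsub>wreath G H\<^esub> (clear_origin g, x)"
proof -
  show c: "(clear_origin g, x) \<in> carrier (wreath G H)"
    using assms wreath_val[OF assms] by (auto simp: mem_wreath supp_clear_origin) (auto simp: clear_origin_def)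
  have "(\<lambda>z\<in>carrier H. if z = \<one>\<^bsub>H\<^esub> then g \<one>\<^bsub>H\<^esub> \<otimes>\<^bsub>G\<^esub> clear_origin g z else clear_origin g z)
      = (\<lambda>z\<in>carrier H. g z)"
    using wreath_val[OF assms] by (auto simp: clear_origin_def intro!: restrict_ext)
  then show "(g, x) = lamp (g \<one>\<^bsub>H\<^esub>) \<otimes>\<^bsub>wreath G H\<^esub> (clear_origin g, x)"
    using c wreath_val[OF assms] by (simp add: lamp_mult wreath_restrict[OF assms])
qed

lemma supp_translate:
  assumes "t \<in> carrier H"
  shows "supp g = (\<lambda>z. t \<otimes>\<^bsub>H\<^esub> z) ` supp (translate t g)"
proof -
  have "z \<in> (\<lambda>z. t \<otimes>\<^bsub>H\<^esub> z) ` supp (translate t g)" if "z \<in> supp g" for z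
  proof (rule image_eqI)
    show "z = t \<otimes>\<^bsub>H\<^esub> (inv\<^bsub>H\<^esub> t \<otimes>\<^bsub>H\<^esub> z)" "inv\<^bsub>H\<^esub> t \<otimes>\<^bsub>H\<^esub> z \<in> supp (translate t g)"
      using that assms by (auto simp: supp_def translate_def H.m_assoc[symmetric])
  qed
  moreover have "t \<otimes>\<^bsub>H\<^esub> z \<in> supp g" if "z \<in> supp (translate t g)" for z
    using that assms by (auto simp: supp_def translate_def)
  ultimately show ?thesis
    by blast
qed

lemma inj_on_mult_left: "t \<in> carrier H \<Longrightarrow> A \<subseteq> carrier H \<Longrightarrow> inj_on (\<lambda>z. t \<otimes>\<^bsub>H\<^esub> z) A"
  by (rule inj_onI) (simp add: subset_iff)

lemma finite_supp_translate:
  assumes "t \<in> carrier H" "finite (supp g)"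
  shows "finite (supp (translate t g))"
  using assms supp_translate[of t g] finite_image_iff[OF inj_on_mult_left[OF _ supp_subset]] by metis

lemma move_factor:
  assumes "(g, x) \<in> carrier (wreath G H)" "t \<in> carrier H"
  shows "(translate t g, inv\<^bsub>H\<^esub> t \<otimes>\<^bsub>H\<^esub> x) \<in> carrier (wreath G H)"
    and "(g, x) = move t \<otimes>\<^bsub>wreath G H\<^esub> (translate t g, inv\<^bsub>H\<^esub> t \<otimes>\<^bsub>H\<^esub> x)"
proof -
  have fin: "finite (supp (translate t g))"
    using assms finite_supp_translate by (simp add: mem_wreath)
  then show c: "(translate t g, inv\<^bsub>H\<^esub> t \<otimes>\<^bsub>H\<^esub> x) \<in> carrier (wreath G H)"
    using assms wreath_val[OF assms(1)] by (auto simp: mem_wreath) (auto simp: translate_def)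
  have x: "x \<in> carrier H"
    using assms by (simp add: mem_wreath)
  have "(\<lambda>z\<in>carrier H. translate t g (inv\<^bsub>H\<^esub> t \<otimes>\<^bsub>H\<^esub> z)) = (\<lambda>z\<in>carrier H. g z)"
    using assms(2) by (auto simp: translate_def H.m_assoc[symmetric] intro!: restrict_ext)
  then show "(g, x) = move t \<otimes>\<^bsub>wreath G H\<^esub> (translate t g, inv\<^bsub>H\<^esub> t \<otimes>\<^bsub>H\<^esub> x)"
    using c assms(2) x by (simp add: move_mult wreath_restrict[OF assms(1)] H.m_assoc[symmetric])
qed

lemma lamplighter_gens_closed:
  "T \<subseteq> carrier H \<Longrightarrow> lamplighter_gens G H T \<subseteq> carrier (wreath G H)"
  by (auto simp: lamplighter_gens_def wreath_gens_eq move_closed lamp_closed)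

text \<open>By induction on the number of lit lamps: step to a lit lamp, which is then at the origin, and
  factor it off.\<close>

lemma generate_lamplighter_gens:
  assumes T: "T \<subseteq> carrier H" "generate H T = carrier H"
  shows "generate (wreath G H) (lamplighter_gens G H T) = carrier (wreath G H)"
proof -
  let ?K = "generate (wreath G H) (lamplighter_gens G H T)"
  note gc = lamplighter_gens_closed[OF T(1)]
  have move: "move x \<in> ?K" if "x \<in> carrier H" for x
  proof -
    have "x \<in> generate H T"
      using that T by simp
    then show ?thesis
    proof (induction rule: generate.induct)
      case one
      then show ?case
        using generate.one[of "wreath G H"] by (simp add: wreath_one)
    next
      case (incl h)
      then show ?case
        by (intro generate.incl) (auto simp: lamplighter_gens_def wreath_gens_eq)
    next
      case (inv h)
      then have "inv\<^bsub>wreath G H\<^esub> move h \<in> ?K"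
        by (intro generate.inv) (auto simp: lamplighter_gens_def wreath_gens_eq)
      then show ?case
        using inv T by (simp add: inv_move subset_iff)
    next
      case (eng h1 h2)
      then have "h1 \<in> carrier H" "h2 \<in> carrier H"
        using T by auto
      then show ?case
        using generate.eng[OF eng.IH] by (simp add: move_move)
    qed
  qed
  have lamp: "lamp s \<in> ?K" if "s \<in> carrier G" for s
  proof (cases "s = \<one>\<^bsub>G\<^esub>")
    case True
    then show ?thesis
      by (simp add: lamp_one generate.one)
  next
    case False
    then show ?thesis
      using that by (intro generate.incl) (auto simp: lamplighter_gens_def wreath_gens_eq)
  qed
  have "(f, x) \<in> ?K" if "(f, x) \<in> carrier (wreath G H)" for f x
    using that
  proof (induction "card (supp f)" arbitrary: f x)
    case 0
    then have "supp f = {}"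
      by (simp add: mem_wreath)
    then show ?case
      using move[of x] 0(2) supp_empty_imp_unlit[OF 0(2)] by (simp add: move_def mem_wreath)
  next
    case (Suc n)
    then obtain z where z: "z \<in> supp f"
      by (metis card.empty ex_in_conv nat.simps(3))
    then have zH: "z \<in> carrier H"
      by (simp add: supp_def)
    let ?g = "translate z f" and ?y = "inv\<^bsub>H\<^esub> z \<otimes>\<^bsub>H\<^esub> x"
    note mf = move_factor[OF Suc.prems zH]
    note lf = lamp_factor[OF mf(1)]
    have one: "\<one>\<^bsub>H\<^esub> \<in> supp ?g"
      using z zH by (simp add: supp_def translate_def)
    have "card (supp ?g) = card (supp f)"
      using card_image[OF inj_on_mult_left[OF zH, of "supp ?g"]] supp_translate[OF zH, of f] supp_subset
      by simp
    then have "n = card (supp (clear_origin ?g))"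
      using Suc(2) one by (simp add: supp_clear_origin)
    then have "(clear_origin ?g, ?y) \<in> ?K"
      using Suc(1) lf(1) by blast
    then have "(?g, ?y) \<in> ?K"
      using lf(2) generate.eng[OF lamp[OF wreath_val[OF mf(1) H.one_closed]]] by metis
    then show ?case
      using mf(2) generate.eng[OF move[OF zH]] by metis
  qed
  then show ?thesis
    using W.generate_incl[OF gc] by auto
qed

lemma lamplighter_letters:
  assumes "T \<subseteq> carrier H" "\<And>t. t \<in> T \<Longrightarrow> inv\<^bsub>H\<^esub> t \<in> T"
  shows "lamplighter_gens G H T \<union> (\<lambda>s. inv\<^bsub>wreath G H\<^esub> s) ` lamplighter_gens G H T
    \<subseteq> move ` T \<union> lamp ` carrier G"
  using assms by (auto simp: lamplighter_gens_def wreath_gens_eq inv_move inv_lamp subset_iff)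

text \<open>A lamplighter word is a tour of the lamplighter through the set \<open>V\<close> of sites where it switches lamps.
  The same tour can be used to produce any other configuration \<open>g\<close> supported on \<open>V\<close>: each lamp is set
  to its final value when its site is switched for the first time, and later switches at that site are
  skipped. The total cost is that of the steps plus that of one switch per site. The quantification
  over all \<open>g\<close> is what the induction needs, because the configuration left after the first switch is
  \<open>g\<close> with the origin cleared and not the configuration produced by the rest of the word.\<close>

lemma tour_bound:
  fixes \<mu> :: "('h \<Rightarrow> 'g) \<times> 'h \<Rightarrow> real" and \<beta> :: "'g \<Rightarrow> real"
  assumes T: "T \<subseteq> carrier H"
    and one: "\<mu> \<one>\<^bsub>wreath G H\<^esub> \<le> 0"
    and subadd: "\<And>a b. a \<in> carrier (wreath G H) \<Longrightarrow> b \<in> carrier (wreath G H) \<Longrightarrow>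
      \<mu> (a \<otimes>\<^bsub>wreath G H\<^esub> b) \<le> \<mu> a + \<mu> b"
    and mu_move: "\<And>t. t \<in> T \<Longrightarrow> \<mu> (move t) \<le> A" and A: "0 \<le> A"
    and mu_lamp: "\<And>s. s \<in> carrier G \<Longrightarrow> \<mu> (lamp s) \<le> \<beta> s" and \<beta>1: "\<beta> \<one>\<^bsub>G\<^esub> = 0"
    and ws: "set ws \<subseteq> move ` T \<union> lamp ` carrier G"
    and prod: "foldr (\<lambda>s y. s \<otimes>\<^bsub>wreath G H\<^esub> y) ws \<one>\<^bsub>wreath G H\<^esub> = (f, x)"
  shows "\<exists>V. finite V \<and> V \<subseteq> carrier H \<and> supp f \<subseteq> V \<and> card V \<le> length ws \<and>
    (\<forall>g. (g, x) \<in> carrier (wreath G H) \<and> supp g \<subseteq> V \<longrightarrow>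
      \<mu> (g, x) \<le> A * real (length ws) + (\<Sum>z\<in>V. \<beta> (g z)))"
  using ws prod
proof (induction ws arbitrary: f x)
  case Nil
  then have fx: "f = unlit" "x = \<one>\<^bsub>H\<^esub>"
    by (simp_all add: wreath_one move_def)
  have "\<mu> (g, x) \<le> 0" if "(g, x) \<in> carrier (wreath G H)" "supp g = {}" for g
    using supp_empty_imp_unlit[OF that] one fx by (simp add: wreath_one move_def)
  then show ?case
    using fx by (intro exI[of _ "{}"]) (simp add: supp_unlit)
next
  case (Cons a ws)
  define b where "b = foldr (\<lambda>s y. s \<otimes>\<^bsub>wreath G H\<^esub> y) ws \<one>\<^bsub>wreath G H\<^esub>"
  obtain f' x' where b: "b = (f', x')"
    by (cases b)
  have ab: "a \<otimes>\<^bsub>wreath G H\<^esub> (f', x') = (f, x)"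
    using Cons.prems by (simp add: b_def[symmetric] b)
  have bc: "(f', x') \<in> carrier (wreath G H)"
  proof -
    have cl: "foldr (\<lambda>s y. s \<otimes>\<^bsub>wreath G H\<^esub> y) us \<one>\<^bsub>wreath G H\<^esub> \<in> carrier (wreath G H)"
      if "set us \<subseteq> move ` T \<union> lamp ` carrier G" for us
      using that
    proof (induction us)
      case (Cons u us)
      then have "u \<in> carrier (wreath G H)"
        using T by (auto simp: move_closed lamp_closed simp del: split_paired_All)
      then show ?case
        using Cons by simp
    qed simp
    show ?thesis
      using cl[of ws] Cons.prems(1) by (simp add: b_def[symmetric] b)
  qed
  obtain V where V: "finite V" "V \<subseteq> carrier H" "supp f' \<subseteq> V" "card V \<le> length ws"
    and bound: "\<And>g. (g, x') \<in> carrier (wreath G H) \<Longrightarrow> supp g \<subseteq> V \<Longrightarrow>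
      \<mu> (g, x') \<le> A * real (length ws) + (\<Sum>z\<in>V. \<beta> (g z))"
    using Cons.IH[of f' x'] Cons.prems b b_def by auto
  from Cons.prems consider t where "t \<in> T" "a = move t" | s where "s \<in> carrier G" "a = lamp s"
    by auto
  then show ?case
  proof cases
    case 1
    then have t: "t \<in> carrier H"
      using T by auto
    have fx: "f = (\<lambda>z\<in>carrier H. f' (inv\<^bsub>H\<^esub> t \<otimes>\<^bsub>H\<^esub> z))" "x = t \<otimes>\<^bsub>H\<^esub> x'"
      using ab move_mult[OF t bc] 1 by auto
    have x': "x' \<in> carrier H"
      using bc by (simp add: mem_wreath)
    have x'eq: "inv\<^bsub>H\<^esub> t \<otimes>\<^bsub>H\<^esub> x = x'"
      using t x' by (simp add: fx H.m_assoc[symmetric])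
    let ?V = "(\<lambda>z. t \<otimes>\<^bsub>H\<^esub> z) ` V"
    \<comment> \<open>After a step to \<open>t\<close> the rest of the tour is seen from \<open>t\<close>.\<close>
    have inj: "inj_on (\<lambda>z. t \<otimes>\<^bsub>H\<^esub> z) V"
      using inj_on_mult_left[OF t V(2)] .
    have sub: "supp (translate t g) \<subseteq> V \<longleftrightarrow> supp g \<subseteq> ?V" for g
      using supp_translate[OF t, of g] inj_on_image_subset_iff[OF inj_on_mult_left[OF t order_refl]] V(2)
      by (auto simp: supp_def subset_iff)
    have "supp (translate t f) \<subseteq> supp f'"
      using t by (auto simp: supp_def translate_def fx H.m_assoc[symmetric])
    then have "supp f \<subseteq> ?V"
      using sub V by blast
    moreover have "\<mu> (g, x) \<le> A * real (length (a # ws)) + (\<Sum>z\<in>?V. \<beta> (g z))"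
      if g: "(g, x) \<in> carrier (wreath G H)" "supp g \<subseteq> ?V" for g
    proof -
      note mf = move_factor[OF g(1) t, unfolded x'eq]
      have "\<mu> (g, x) = \<mu> (move t \<otimes>\<^bsub>wreath G H\<^esub> (translate t g, x'))"
        using mf(2) by simp
      also have "\<dots> \<le> \<mu> (move t) + \<mu> (translate t g, x')"
        by (intro subadd move_closed t mf(1))
      also have "\<dots> \<le> A + (A * real (length ws) + (\<Sum>z\<in>V. \<beta> (translate t g z)))"
        using mu_move[OF 1(1)] bound[OF mf(1)] g(2) sub by (simp add: add_mono)
      also have "(\<Sum>z\<in>V. \<beta> (translate t g z)) = (\<Sum>z\<in>?V. \<beta> (g z))"
        using V(2) by (auto simp: sum.reindex[OF inj] translate_def intro!: sum.cong)
      finally show ?thesis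
        by (simp add: algebra_simps)
    qed
    ultimately show ?thesis
      using V t by (intro exI[of _ ?V]) (auto simp: card_image[OF inj])
  next
    case 2
    have fx: "f = (\<lambda>z\<in>carrier H. if z = \<one>\<^bsub>H\<^esub> then s \<otimes>\<^bsub>G\<^esub> f' z else f' z)" "x = x'"
      using ab lamp_mult[OF 2(1) bc] 2 by auto
    let ?V = "insert \<one>\<^bsub>H\<^esub> V"
    have "supp f \<subseteq> ?V"
      using V(3) by (auto simp: supp_def fx split: if_splits)
    moreover have "card ?V \<le> length (a # ws)"
      using V(4) card_insert_le_m1[of "Suc (length ws)" V "\<one>\<^bsub>H\<^esub>"] by simp
    moreover have "\<mu> (g, x) \<le> A * real (length (a # ws)) + (\<Sum>z\<in>?V. \<beta> (g z))"
      if g: "(g, x) \<in> carrier (wreath G H)" "supp g \<subseteq> ?V" for g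
    proof -
      note lf = lamp_factor[OF g(1)]
      have g1: "g \<one>\<^bsub>H\<^esub> \<in> carrier G"
        using wreath_val[OF g(1)] by simp
      have "\<mu> (g, x) = \<mu> (lamp (g \<one>\<^bsub>H\<^esub>) \<otimes>\<^bsub>wreath G H\<^esub> (clear_origin g, x))"
        using lf(2) by simp
      also have "\<dots> \<le> \<mu> (lamp (g \<one>\<^bsub>H\<^esub>)) + \<mu> (clear_origin g, x)"
        by (intro subadd lamp_closed g1 lf(1))
      also have "\<dots> \<le> \<beta> (g \<one>\<^bsub>H\<^esub>) + (A * real (length ws) + (\<Sum>z\<in>V. \<beta> (clear_origin g z)))"
        using mu_lamp[OF g1] bound[of "clear_origin g"] lf(1) g(2)
        by (intro add_mono) (auto simp: fx supp_clear_origin)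
      \<comment> \<open>The origin may already belong to \<open>V\<close>; once cleared, it is charged only for the first switch.\<close>
      also have "(\<Sum>z\<in>V. \<beta> (clear_origin g z)) = (\<Sum>z\<in>V - {\<one>\<^bsub>H\<^esub>}. \<beta> (clear_origin g z))"
        using V(1) \<beta>1 by (intro sum.mono_neutral_right) (auto simp: clear_origin_def)
      also have "\<dots> = (\<Sum>z\<in>V - {\<one>\<^bsub>H\<^esub>}. \<beta> (g z))"
        using V(2) by (intro sum.cong) (auto simp: clear_origin_def)
      finally have "\<mu> (g, x) \<le> A * real (length ws) + (\<Sum>z\<in>?V. \<beta> (g z))"
        using V(1) by (simp add: sum.insert_remove)
      then show ?thesis
        using A by (simp add: algebra_simps)
    qed
    ultimately show ?thesis
      using V by (intro exI[of _ ?V]) auto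
  qed
qed

definition lamp_cost :: "('g \<Rightarrow> real) \<Rightarrow> ('h \<Rightarrow> 'g) \<Rightarrow> real" where
  "lamp_cost \<beta> f = (\<Sum>z\<in>supp f. \<beta> (f z))"

lemma lamp_cost_eq_sum:
  assumes "finite V" "supp f \<subseteq> V" "V \<subseteq> carrier H" "\<beta> \<one>\<^bsub>G\<^esub> = 0"
  shows "lamp_cost \<beta> f = (\<Sum>z\<in>V. \<beta> (f z))"
  unfolding lamp_cost_def
  by (rule sum.mono_neutral_left) (use assms in \<open>auto simp: supp_def\<close>)

lemma lamp_cost_translate:
  assumes "t \<in> carrier H"
  shows "lamp_cost \<beta> (translate t f) = lamp_cost \<beta> f"
  unfolding lamp_cost_def
  by (subst (2) supp_translate[OF assms], subst sum.reindex[OF inj_on_mult_left[OF assms supp_subset]])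
    (auto simp: translate_def supp_def intro!: sum.cong)

lemma card_supp_translate:
  assumes "t \<in> carrier H"
  shows "card (supp (translate t f)) = card (supp f)"
  using card_image[OF inj_on_mult_left[OF assms supp_subset]] supp_translate[OF assms, of f] by metis

lemma lamp_cost_mult_le:
  assumes f: "(f, x) \<in> carrier (wreath G H)" and g: "(g, y) \<in> carrier (wreath G H)"
    and \<beta>1: "\<beta> \<one>\<^bsub>G\<^esub> = 0"
    and subadd: "\<And>a b. a \<in> carrier G \<Longrightarrow> b \<in> carrier G \<Longrightarrow> \<beta> (a \<otimes>\<^bsub>G\<^esub> b) \<le> \<beta> a + \<beta> b"
  shows "lamp_cost \<beta> (fst ((f, x) \<otimes>\<^bsub>wreath G H\<^esub> (g, y))) \<le> lamp_cost \<beta> f + lamp_cost \<beta> g"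
proof -
  have x: "inv\<^bsub>H\<^esub> x \<in> carrier H"
    using f by (simp add: mem_wreath)
  let ?g = "translate (inv\<^bsub>H\<^esub> x) g"
  let ?h = "\<lambda>z\<in>carrier H. f z \<otimes>\<^bsub>G\<^esub> g (inv\<^bsub>H\<^esub> x \<otimes>\<^bsub>H\<^esub> z)"
  let ?V = "supp f \<union> supp ?g"
  have V: "finite ?V" "?V \<subseteq> carrier H"
    using f g finite_supp_translate[OF x] supp_subset by (auto simp: mem_wreath)
  have h: "?h z = f z \<otimes>\<^bsub>G\<^esub> ?g z" if "z \<in> carrier H" for z
    using that by (simp add: translate_def)
  have gz: "?g z \<in> carrier G" if "z \<in> carrier H" for z
    using that x wreath_val[OF g] by (simp add: translate_def)
  have "?h z = \<one>\<^bsub>G\<^esub>" if "z \<in> carrier H" "z \<notin> ?V" for z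
  proof -
    have "f z = \<one>\<^bsub>G\<^esub>" "?g z = \<one>\<^bsub>G\<^esub>"
      using that by (auto simp: supp_def)
    then show ?thesis
      by (simp only: h[OF that(1)]) simp
  qed
  then have "supp ?h \<subseteq> ?V"
    by (fastforce simp only: supp_def)
  then have "lamp_cost \<beta> ?h = (\<Sum>z\<in>?V. \<beta> (?h z))"
    using V \<beta>1 by (intro lamp_cost_eq_sum) auto
  also have "\<dots> \<le> (\<Sum>z\<in>?V. \<beta> (f z) + \<beta> (?g z))"
  proof (rule sum_mono)
    fix z assume "z \<in> ?V"
    then have z: "z \<in> carrier H"
      using V by auto
    show "\<beta> (?h z) \<le> \<beta> (f z) + \<beta> (?g z)"
      unfolding h[OF z] by (rule subadd[OF wreath_val[OF f z] gz[OF z]])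
  qed
  also have "\<dots> = lamp_cost \<beta> f + lamp_cost \<beta> ?g"
    using lamp_cost_eq_sum[where V="?V" and \<beta>=\<beta>, OF V(1) _ V(2) \<beta>1] by (simp add: sum.distrib)
  finally show ?thesis
    using lamp_cost_translate[OF x] by (simp add: wreath_mult)
qed

definition diff :: "('h \<Rightarrow> 'g) \<Rightarrow> ('h \<Rightarrow> 'g) \<Rightarrow> 'h set" where
  "diff f g = {z \<in> carrier H. f z \<noteq> g z}"

lemma finite_diff:
  assumes "(f, x) \<in> carrier (wreath G H)" "(g, y) \<in> carrier (wreath G H)"
  shows "finite (diff f g)"
  by (rule finite_subset[of _ "supp f \<union> supp g"])
    (use assms in \<open>auto simp: mem_wreath diff_def supp_def\<close>)

definition lamp_quotient :: "('h \<Rightarrow> 'g) \<Rightarrow> ('h \<Rightarrow> 'g) \<Rightarrow> 'h \<Rightarrow> 'g" where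
  "lamp_quotient f g = (\<lambda>z\<in>carrier H. inv\<^bsub>G\<^esub> (f z) \<otimes>\<^bsub>G\<^esub> g z)"

lemma supp_lamp_quotient:
  assumes "(f, x) \<in> carrier (wreath G H)" "(g, y) \<in> carrier (wreath G H)"
  shows "supp (lamp_quotient f g) = diff f g"
proof -
  have "inv\<^bsub>G\<^esub> (f z) \<otimes>\<^bsub>G\<^esub> g z = \<one>\<^bsub>G\<^esub> \<longleftrightarrow> f z = g z" if "z \<in> carrier H" for z
    using wreath_val[OF assms(1) that] wreath_val[OF assms(2) that]
    by (metis G.inv_closed G.inv_equality G.inv_inv G.l_inv)
  then show ?thesis
    by (auto simp: supp_def diff_def lamp_quotient_def)
qed

text \<open>Distances are lengths of quotients. The lamps of the quotient are the pointwise quotients of the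
  lamps, recentred at \<open>x\<close>.\<close>

lemma wreath_quotient:
  assumes f: "(f, x) \<in> carrier (wreath G H)" and g: "(g, y) \<in> carrier (wreath G H)"
  defines "h \<equiv> translate x (lamp_quotient f g)"
  shows "inv\<^bsub>wreath G H\<^esub> (f, x) \<otimes>\<^bsub>wreath G H\<^esub> (g, y) = (h, inv\<^bsub>H\<^esub> x \<otimes>\<^bsub>H\<^esub> y)"
    and "(h, inv\<^bsub>H\<^esub> x \<otimes>\<^bsub>H\<^esub> y) \<in> carrier (wreath G H)"
proof -
  have xy: "x \<in> carrier H" "y \<in> carrier H"
    using f g by (auto simp: mem_wreath)
  have q: "lamp_quotient f g z \<in> carrier G" if "z \<in> carrier H" for z
    using that wreath_val[OF f that] wreath_val[OF g that] by (simp add: lamp_quotient_def)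
  have "finite (supp h)"
    unfolding h_def using xy supp_lamp_quotient[OF f g] finite_diff[OF f g]
    by (intro finite_supp_translate) auto
  then show h: "(h, inv\<^bsub>H\<^esub> x \<otimes>\<^bsub>H\<^esub> y) \<in> carrier (wreath G H)"
    using xy q by (auto simp: mem_wreath) (auto simp: h_def translate_def)
  have "(\<lambda>z\<in>carrier H. f z \<otimes>\<^bsub>G\<^esub> h (inv\<^bsub>H\<^esub> x \<otimes>\<^bsub>H\<^esub> z)) = (\<lambda>z\<in>carrier H. g z)"
    using xy wreath_val[OF f] wreath_val[OF g]
    by (auto simp: h_def translate_def lamp_quotient_def H.m_assoc[symmetric] G.m_assoc[symmetric]
        intro!: restrict_ext)
  then have "(f, x) \<otimes>\<^bsub>wreath G H\<^esub> (h, inv\<^bsub>H\<^esub> x \<otimes>\<^bsub>H\<^esub> y) = (g, y)"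
    using xy by (simp add: wreath_mult wreath_restrict[OF g] H.m_assoc[symmetric])
  then show "inv\<^bsub>wreath G H\<^esub> (f, x) \<otimes>\<^bsub>wreath G H\<^esub> (g, y) = (h, inv\<^bsub>H\<^esub> x \<otimes>\<^bsub>H\<^esub> y)"
    using W.inv_solve_left[OF h f g] by simp
qed

lemma generated_lamplighter:
  assumes "symmetric_generating_set H T"
  shows "generated_group (wreath G H) (lamplighter_gens G H T)"
  using assms lamplighter_gens_closed[of T] generate_lamplighter_gens[of T] W.is_group
  by (simp add: generated_group_def generated_group_axioms_def symmetric_generating_set_def)

text \<open>Apply the tour bound to a shortest lamplighter word for \<open>(f, x)\<close> and to the configuration \<open>f\<close> itself,
  with the word length of the wreath product as the subadditive function.\<close>

lemma wreath_length_upper: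
  assumes S: "finite S" "symmetric_generating_set G S" and T: "finite T" "symmetric_generating_set H T"
    and WW: "generated_group (wreath G H) W"
  obtains K where "0 < K" and "\<And>f x. (f, x) \<in> carrier (wreath G H) \<Longrightarrow>
      real (word_length (wreath G H) W (f, x))
      \<le> K * (real (word_length (wreath G H) (lamplighter_gens G H T) (f, x))
            + lamp_cost (\<lambda>s. real (word_length G S s)) f)"
    and "\<And>f x. (f, x) \<in> carrier (wreath G H) \<Longrightarrow>
      card (supp f) \<le> word_length (wreath G H) (lamplighter_gens G H T) (f, x)"
proof -
  interpret S: generated_group G S
    using symmetric_generating_set_imp_generated_group[OF G.is_group S(2)] .
  interpret L: generated_group "wreath G H" "lamplighter_gens G H T"
    using generated_lamplighter[OF T(2)] .
  interpret WW: generated_group "wreath G H" W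
    by (rule WW)
  have TH: "T \<subseteq> carrier H" "\<And>t. t \<in> T \<Longrightarrow> inv\<^bsub>H\<^esub> t \<in> T"
    using T(2) by (auto simp: symmetric_generating_set_def)
  define K where "K = 1 + Max (insert 0 (WW.len ` (move ` T \<union> lamp ` S.letters)))"
  have K: "WW.len a \<le> K" if "a \<in> move ` T \<union> lamp ` S.letters" for a
    unfolding K_def using that S T by (intro trans_le_add2 Max_ge) auto
  have lampK: "real (WW.len (lamp s)) \<le> real K * real (S.len s)" if "s \<in> carrier G" for s
  proof (rule S.subadditive_le_len[OF _ _ _ that])
    show "real (WW.len (lamp \<one>\<^bsub>G\<^esub>)) \<le> 0"
      by (simp add: lamp_one WW.len_one)
    show "real (WW.len (lamp (a \<otimes>\<^bsub>G\<^esub> b))) \<le> real (WW.len (lamp a)) + real (WW.len (lamp b))"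
      if "a \<in> carrier G" "b \<in> carrier G" for a b
      using that WW.len_mult_le[OF lamp_closed lamp_closed, of a b] by (simp add: lamp_lamp)
    show "real (WW.len (lamp s)) \<le> real K" if "s \<in> S.letters" for s
      using K that by simp
  qed
  have main: "card (supp f) \<le> L.len (f, x) \<and>
      real (WW.len (f, x)) \<le> real K * (real (L.len (f, x)) + lamp_cost (\<lambda>s. real (S.len s)) f)"
    if f: "(f, x) \<in> carrier (wreath G H)" for f x
  proof -
    obtain ws where ws: "length ws = L.len (f, x)" "set ws \<subseteq> L.letters" "L.word_prod ws = (f, x)"
      using L.geodesic_word_exists[OF f] by auto
    have ws': "set ws \<subseteq> move ` T \<union> lamp ` carrier G"
      using ws(2) lamplighter_letters[OF TH] by blast
    have subadd: "real (WW.len (a \<otimes>\<^bsub>wreath G H\<^esub> b)) \<le> real (WW.len a) + real (WW.len b)"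
      if "a \<in> carrier (wreath G H)" "b \<in> carrier (wreath G H)" for a b
      using WW.len_mult_le[OF that] by simp
    obtain V where V: "finite V" "V \<subseteq> carrier H" "supp f \<subseteq> V" "card V \<le> length ws"
      and bound: "\<forall>g. (g, x) \<in> carrier (wreath G H) \<and> supp g \<subseteq> V \<longrightarrow>
        real (WW.len (g, x)) \<le> real K * real (length ws) + (\<Sum>z\<in>V. real K * real (S.len (g z)))"
      using tour_bound[OF TH(1), of "\<lambda>a. real (WW.len a)" "real K" "\<lambda>s. real K * real (S.len s)",
          OF _ subadd _ _ lampK _ ws' ws(3)] K
      by (auto simp: WW.len_one S.len_one)
    have "card (supp f) \<le> L.len (f, x)"
      using card_mono[OF V(1,3)] V(4) ws(1) by simp
    moreover have "real (WW.len (f, x)) \<le> real K * real (L.len (f, x)) + real K * (\<Sum>z\<in>V. real (S.len (f z)))"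
      using bound f V(3) ws(1) by (auto simp: sum_distrib_left)
    moreover have "lamp_cost (\<lambda>s. real (S.len s)) f = (\<Sum>z\<in>V. real (S.len (f z)))"
      using V by (intro lamp_cost_eq_sum) (auto simp: S.len_one)
    ultimately show ?thesis
      by (simp add: distrib_left)
  qed
  show ?thesis
    by (rule that[of "real K"]) (use main in \<open>auto simp: K_def\<close>)
qed

text \<open>The left-hand side is subadditive, hence bounded by a multiple of the word length.\<close>

lemma wreath_length_lower:
  assumes S: "symmetric_generating_set G S" and T: "symmetric_generating_set H T"
    and WW: "generated_group (wreath G H) W" "finite W"
  obtains K where "0 < K" and "\<And>f x. (f, x) \<in> carrier (wreath G H) \<Longrightarrow>
      real (word_length (wreath G H) (lamplighter_gens G H T) (f, x))
        + lamp_cost (\<lambda>s. real (word_length G S s)) f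
      \<le> K * real (word_length (wreath G H) W (f, x))"
proof -
  interpret S: generated_group G S
    using symmetric_generating_set_imp_generated_group[OF G.is_group S] .
  interpret L: generated_group "wreath G H" "lamplighter_gens G H T"
    using generated_lamplighter[OF T] .
  interpret WW: generated_group "wreath G H" W
    by (rule WW)
  define \<mu> where "\<mu> = (\<lambda>a. real (L.len a) + lamp_cost (\<lambda>s. real (S.len s)) (fst a))"
  define K where "K = 1 + Max (insert 0 (\<mu> ` WW.letters))"
  have fin: "finite (insert 0 (\<mu> ` WW.letters))"
    using WW(2) by simp
  have K: "\<mu> a \<le> K" if "a \<in> WW.letters" for a
  proof -
    have "\<mu> a \<le> Max (insert 0 (\<mu> ` WW.letters))"
      using that fin by (intro Max_ge) auto
    then show ?thesis
      by (simp add: K_def)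
  qed
  have "0 \<le> Max (insert 0 (\<mu> ` WW.letters))"
    using fin by (intro Max_ge) auto
  then have K0: "0 < K"
    by (simp add: K_def)
  have "\<mu> a \<le> K * real (WW.len a)" if "a \<in> carrier (wreath G H)" for a
  proof (rule WW.subadditive_le_len[OF _ _ K that])
    show "\<mu> \<one>\<^bsub>wreath G H\<^esub> \<le> 0"
      by (simp add: \<mu>_def L.len_one) (simp add: wreath_one move_def lamp_cost_def supp_unlit)
    show "\<mu> (a \<otimes>\<^bsub>wreath G H\<^esub> b) \<le> \<mu> a + \<mu> b"
      if ab: "a \<in> carrier (wreath G H)" "b \<in> carrier (wreath G H)" for a b
    proof -
      obtain f x g y where eq: "a = (f, x)" "b = (g, y)"
        by (cases a, cases b)
      have "lamp_cost (\<lambda>s. real (S.len s)) (fst (a \<otimes>\<^bsub>wreath G H\<^esub> b))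
          \<le> lamp_cost (\<lambda>s. real (S.len s)) f + lamp_cost (\<lambda>s. real (S.len s)) g"
        unfolding eq using ab S.len_mult_le
        by (intro lamp_cost_mult_le) (auto simp: eq S.len_one of_nat_add[symmetric] simp del: of_nat_add)
      then show ?thesis
        using L.len_mult_le[OF ab] by (simp add: \<mu>_def eq)
    qed
  qed
  then show ?thesis
    using K0 by (intro that[of K]) (auto simp: \<mu>_def)
qed

text \<open>These are the length bounds for the quotient of two elements: recentring the quotient turns its lamp
  cost into the sum of the distances between the lamps, over the sites where the lamps differ.\<close>

lemma word_dist_comparison:
  assumes S: "finite S" "symmetric_generating_set G S" and T: "finite T" "symmetric_generating_set H T"
    and W: "finite W" "symmetric_generating_set (wreath G H) W"
  obtains K K' where "0 < K" "0 < K'"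
    and "\<And>f x g y. (f, x) \<in> carrier (wreath G H) \<Longrightarrow> (g, y) \<in> carrier (wreath G H) \<Longrightarrow>
      card (diff f g) \<le> word_dist (wreath G H) (lamplighter_gens G H T) (f, x) (g, y)"
    and "\<And>f x g y. (f, x) \<in> carrier (wreath G H) \<Longrightarrow> (g, y) \<in> carrier (wreath G H) \<Longrightarrow>
      real (word_dist (wreath G H) W (f, x) (g, y))
      \<le> K * (real (word_dist (wreath G H) (lamplighter_gens G H T) (f, x) (g, y))
            + (\<Sum>z\<in>diff f g. real (word_dist G S (f z) (g z))))"
    and "\<And>f x g y. (f, x) \<in> carrier (wreath G H) \<Longrightarrow> (g, y) \<in> carrier (wreath G H) \<Longrightarrow>
      real (word_dist (wreath G H) (lamplighter_gens G H T) (f, x) (g, y))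
        + (\<Sum>z\<in>diff f g. real (word_dist G S (f z) (g z)))
      \<le> K' * real (word_dist (wreath G H) W (f, x) (g, y))"
proof -
  have WW: "generated_group (wreath G H) W"
    using symmetric_generating_set_imp_generated_group[OF W.is_group W(2)] .
  obtain K where K: "0 < K" "\<And>f x. (f, x) \<in> carrier (wreath G H) \<Longrightarrow>
      real (word_length (wreath G H) W (f, x))
      \<le> K * (real (word_length (wreath G H) (lamplighter_gens G H T) (f, x))
            + lamp_cost (\<lambda>s. real (word_length G S s)) f)"
    "\<And>f x. (f, x) \<in> carrier (wreath G H) \<Longrightarrow>
      card (supp f) \<le> word_length (wreath G H) (lamplighter_gens G H T) (f, x)"
    by (rule wreath_length_upper[OF S T WW], rule that)
  obtain K' where K': "0 < K'" "\<And>f x. (f, x) \<in> carrier (wreath G H) \<Longrightarrow>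
      real (word_length (wreath G H) (lamplighter_gens G H T) (f, x))
        + lamp_cost (\<lambda>s. real (word_length G S s)) f
      \<le> K' * real (word_length (wreath G H) W (f, x))"
    by (rule wreath_length_lower[OF S(2) T(2) WW W(1)], rule that)
  have quot: "card (supp (translate x (lamp_quotient f g))) = card (diff f g)"
    "lamp_cost (\<lambda>s. real (word_length G S s)) (translate x (lamp_quotient f g))
      = (\<Sum>z\<in>diff f g. real (word_dist G S (f z) (g z)))"
    if fg: "(f, x) \<in> carrier (wreath G H)" "(g, y) \<in> carrier (wreath G H)" for f x g y
  proof -
    have x: "x \<in> carrier H"
      using fg by (simp add: mem_wreath)
    note s = supp_lamp_quotient[OF fg]
    show "card (supp (translate x (lamp_quotient f g))) = card (diff f g)"
      by (simp add: card_supp_translate[OF x] s)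
    show "lamp_cost (\<lambda>s. real (word_length G S s)) (translate x (lamp_quotient f g))
      = (\<Sum>z\<in>diff f g. real (word_dist G S (f z) (g z)))"
      unfolding lamp_cost_translate[OF x] unfolding lamp_cost_def s
      by (rule sum.cong) (auto simp: lamp_quotient_def word_dist_def diff_def)
  qed
  show ?thesis
  proof (rule that[OF K(1) K'(1)])
    fix f x g y
    assume fg: "(f, x) \<in> carrier (wreath G H)" "(g, y) \<in> carrier (wreath G H)"
    note wq = wreath_quotient[OF fg]
    show "card (diff f g) \<le> word_dist (wreath G H) (lamplighter_gens G H T) (f, x) (g, y)"
      using K(3)[OF wq(2)] by (simp add: word_dist_def[of "wreath G H"] wq(1) quot[OF fg])
    show "real (word_dist (wreath G H) W (f, x) (g, y))
      \<le> K * (real (word_dist (wreath G H) (lamplighter_gens G H T) (f, x) (g, y))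
            + (\<Sum>z\<in>diff f g. real (word_dist G S (f z) (g z))))"
      using K(2)[OF wq(2)] by (simp add: word_dist_def[of "wreath G H"] wq(1) quot[OF fg])
    show "real (word_dist (wreath G H) (lamplighter_gens G H T) (f, x) (g, y))
        + (\<Sum>z\<in>diff f g. real (word_dist G S (f z) (g z)))
      \<le> K' * real (word_dist (wreath G H) W (f, x) (g, y))"
      using K'(2)[OF wq(2)] by (simp add: word_dist_def[of "wreath G H"] wq(1) quot[OF fg])
  qed
qed

end

section \<open>Compression exponents\<close>

text \<open>The distance is computed over any finite set \<open>D\<close> outside which the components of the two points
  agree; all components of a single point but finitely many vanish, so that its image is a finite sum
  of blocks. Block 0 carries \<open>\<phi>\<close>.\<close>

lemma Lp_direct_sum:
  fixes \<phi> :: "'x \<Rightarrow> real \<Rightarrow> real" and \<psi> :: "'x \<Rightarrow> 'z \<Rightarrow> real \<Rightarrow> real"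
  assumes p: "0 < p" and Z: "countable Z"
    and \<phi>: "\<And>x. x \<in> X \<Longrightarrow> \<phi> x \<in> Lp_space p"
    and \<psi>: "\<And>x z. x \<in> X \<Longrightarrow> z \<in> Z \<Longrightarrow> \<psi> x z \<in> Lp_space p"
    and fin: "\<And>x. x \<in> X \<Longrightarrow> finite {z \<in> Z. \<psi> x z \<noteq> (\<lambda>t. 0)}"
  shows "\<exists>F. F \<in> X \<rightarrow> Lp_space p \<and>
    (\<forall>x\<in>X. \<forall>y\<in>X. \<forall>D. finite D \<and> D \<subseteq> Z \<and> (\<forall>z\<in>Z - D. \<psi> x z = \<psi> y z) \<longrightarrow>
      Lp_energy p (\<lambda>t. F x t - F y t) = Lp_energy p (\<lambda>t. \<phi> x t - \<phi> y t)
        + (\<Sum>z\<in>D. Lp_energy p (\<lambda>t. \<psi> x z t - \<psi> y z t)))"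
proof -
  let ?\<iota> = "to_nat_on Z"
  define coord where "coord = (\<lambda>x n. case n of 0 \<Rightarrow> \<phi> x
    | Suc m \<Rightarrow> if m \<in> ?\<iota> ` Z then \<psi> x (from_nat_into Z m) else (\<lambda>t. 0))"
  have c0: "coord x 0 = \<phi> x" for x
    by (simp add: coord_def)
  have cS: "coord x (Suc (?\<iota> z)) = \<psi> x z" if "z \<in> Z" for x z
    using that Z by (simp add: coord_def)
  have cZ: "coord x (Suc m) = (\<lambda>t. 0)" if "m \<notin> ?\<iota> ` Z" for x m
    using that by (simp add: coord_def)
  define F where "F = (\<lambda>x. glue p (coord x))"
  have inj: "inj_on (\<lambda>z. Suc (?\<iota> z)) Z"
    using inj_on_to_nat_on[OF Z] by (simp add: inj_on_def)
  have "F x \<in> Lp_space p" if x: "x \<in> X" for x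
    unfolding F_def
  proof (rule glue_isometric(1)[OF p])
    let ?A = "insert 0 ((\<lambda>z. Suc (?\<iota> z)) ` {z \<in> Z. \<psi> x z \<noteq> (\<lambda>t. 0)})"
    show "finite ?A"
      using fin[OF x] by simp
    show "coord x n \<in> Lp_space p" if "n \<in> ?A" for n
      using that \<phi>[OF x] \<psi>[OF x] by (auto simp: c0 cS)
    show "coord x n = (\<lambda>t. 0)" if "n \<notin> ?A" for n
    proof (cases n)
      case (Suc m)
      show ?thesis
      proof (cases "m \<in> ?\<iota> ` Z")
        case True
        then obtain z where "z \<in> Z" "m = ?\<iota> z"
          by auto
        then show ?thesis
          using that Suc by (auto simp: cS)
      qed (simp add: Suc cZ)
    qed (use that in simp)
  qed
  moreover have "Lp_energy p (\<lambda>t. F x t - F y t) = Lp_energy p (\<lambda>t. \<phi> x t - \<phi> y t)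
        + (\<Sum>z\<in>D. Lp_energy p (\<lambda>t. \<psi> x z t - \<psi> y z t))"
    if xy: "x \<in> X" "y \<in> X" and D: "finite D" "D \<subseteq> Z" and eq: "\<And>z. z \<in> Z - D \<Longrightarrow> \<psi> x z = \<psi> y z" for x y D
  proof -
    let ?c = "\<lambda>n t. coord x n t - coord y n t"
    let ?A = "insert 0 ((\<lambda>z. Suc (?\<iota> z)) ` D)"
    have "Lp_energy p (\<lambda>t. F x t - F y t) = Lp_energy p (glue p ?c)"
      by (simp add: F_def glue_diff)
    also have "\<dots> = (\<Sum>n\<in>?A. Lp_energy p (?c n))"
    proof (rule glue_isometric(2)[OF p])
      show "finite ?A"
        using D by simp
      show "?c n \<in> Lp_space p" if "n \<in> ?A" for n
        using that p D(2) \<phi>[OF xy(1)] \<phi>[OF xy(2)] \<psi>[OF xy(1)] \<psi>[OF xy(2)]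
        by (auto simp: c0 cS subset_iff intro!: Lp_space_diff)
      show "?c n = (\<lambda>t. 0)" if "n \<notin> ?A" for n
      proof (cases n)
        case (Suc m)
        show ?thesis
        proof (cases "m \<in> ?\<iota> ` Z")
          case True
          then obtain z where "z \<in> Z" "m = ?\<iota> z"
            by auto
          then have "z \<in> Z - D"
            using that Suc by auto
          then show ?thesis
            using \<open>m = ?\<iota> z\<close> Suc eq[of z] by (simp add: cS)
        qed (simp add: Suc cZ)
      qed (use that in simp)
    qed
    also have "\<dots> = Lp_energy p (?c 0) + (\<Sum>n\<in>(\<lambda>z. Suc (?\<iota> z)) ` D. Lp_energy p (?c n))"
      using D(1) by (subst sum.insert) auto
    also have "(\<Sum>n\<in>(\<lambda>z. Suc (?\<iota> z)) ` D. Lp_energy p (?c n))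
        = (\<Sum>z\<in>D. Lp_energy p (\<lambda>t. \<psi> x z t - \<psi> y z t))"
      using D(2) by (subst sum.reindex[OF inj_on_subset[OF inj D(2)]]) (auto simp: cS intro!: sum.cong)
    finally show ?thesis
      by (simp add: c0)
  qed
  ultimately show ?thesis
    by (intro exI[of _ F] conjI ballI allI impI) auto
qed

lemma Lp_energy_zero: "Lp_energy p (\<lambda>t. 0) = 0"
  by (simp add: Lp_energy_const)

lemma Lp_embeds_energyE:
  assumes "Lp_embeds_with_exponent p \<Gamma> S \<alpha>" and p: "1 \<le> p"
  obtains f L c where "f \<in> carrier \<Gamma> \<rightarrow> Lp_space p" "0 \<le> L" "0 < c"
    and "\<And>x y. x \<in> carrier \<Gamma> \<Longrightarrow> y \<in> carrier \<Gamma> \<Longrightarrow>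
      Lp_energy p (\<lambda>t. f x t - f y t) \<le> L * real (word_dist \<Gamma> S x y) powr p"
    and "\<And>x y. x \<in> carrier \<Gamma> \<Longrightarrow> y \<in> carrier \<Gamma> \<Longrightarrow> x \<noteq> y \<Longrightarrow>
      c * real (word_dist \<Gamma> S x y) powr (p * \<alpha>) \<le> Lp_energy p (\<lambda>t. f x t - f y t)"
proof -
  obtain f L c where f: "f \<in> carrier \<Gamma> \<rightarrow> Lp_space p" and c: "0 < c"
    and up: "\<forall>x\<in>carrier \<Gamma>. \<forall>y\<in>carrier \<Gamma>.
      Lp_norm p (\<lambda>t. f x t - f y t) \<le> L * real (word_dist \<Gamma> S x y)"
    and low: "\<forall>x\<in>carrier \<Gamma>. \<forall>y\<in>carrier \<Gamma>. x \<noteq> y \<longrightarrow>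
      Lp_norm p (\<lambda>t. f x t - f y t) \<ge> c * real (word_dist \<Gamma> S x y) powr \<alpha>"
    using assms(1) unfolding Lp_embeds_with_exponent_def by (elim exE conjE) (rule that)
  show ?thesis
  proof (rule that[OF f, of "\<bar>L\<bar> powr p" "c powr p"])
    fix x y assume xy: "x \<in> carrier \<Gamma>" "y \<in> carrier \<Gamma>"
    have "Lp_norm p (\<lambda>t. f x t - f y t) \<le> \<bar>L\<bar> * real (word_dist \<Gamma> S x y)"
      by (rule order_trans[OF up[rule_format, OF xy]]) (simp add: mult_right_mono)
    then have "Lp_norm p (\<lambda>t. f x t - f y t) powr p \<le> (\<bar>L\<bar> * real (word_dist \<Gamma> S x y)) powr p"
      using p by (intro powr_mono2) (auto simp: Lp_norm_def)
    then show "Lp_energy p (\<lambda>t. f x t - f y t) \<le> \<bar>L\<bar> powr p * real (word_dist \<Gamma> S x y) powr p"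
      using p by (simp add: Lp_norm_powr powr_mult)
    assume "x \<noteq> y"
    then have "(c * real (word_dist \<Gamma> S x y) powr \<alpha>) powr p \<le> Lp_norm p (\<lambda>t. f x t - f y t) powr p"
      using low[rule_format, OF xy] p c by (intro powr_mono2) auto
    then show "c powr p * real (word_dist \<Gamma> S x y) powr (p * \<alpha>) \<le> Lp_energy p (\<lambda>t. f x t - f y t)"
      using p c by (simp add: Lp_norm_powr powr_mult powr_powr mult.commute)
  qed (use c in auto)
qed

lemma Lp_embeds_energyI:
  assumes p: "1 \<le> p" and f: "f \<in> carrier \<Gamma> \<rightarrow> Lp_space p" and L: "0 \<le> L" and c: "0 < c"
    and up: "\<And>x y. x \<in> carrier \<Gamma> \<Longrightarrow> y \<in> carrier \<Gamma> \<Longrightarrow>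
      Lp_energy p (\<lambda>t. f x t - f y t) \<le> L * real (word_dist \<Gamma> S x y) powr p"
    and low: "\<And>x y. x \<in> carrier \<Gamma> \<Longrightarrow> y \<in> carrier \<Gamma> \<Longrightarrow> x \<noteq> y \<Longrightarrow>
      c * real (word_dist \<Gamma> S x y) powr (p * \<alpha>) \<le> Lp_energy p (\<lambda>t. f x t - f y t)"
  shows "Lp_embeds_with_exponent p \<Gamma> S \<alpha>"
  unfolding Lp_embeds_with_exponent_def
proof (rule exI[of _ f], rule exI[of _ "L powr (1 / p)"], rule exI[of _ "c powr (1 / p)"],
    intro conjI ballI impI)
  fix x y assume xy: "x \<in> carrier \<Gamma>" "y \<in> carrier \<Gamma>"
  have "Lp_energy p (\<lambda>t. f x t - f y t) powr (1 / p) \<le> (L * real (word_dist \<Gamma> S x y) powr p) powr (1 / p)"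
    using up[OF xy] p by (intro powr_mono2) (auto simp: Lp_energy_nonneg)
  then show "Lp_norm p (\<lambda>t. f x t - f y t) \<le> L powr (1 / p) * real (word_dist \<Gamma> S x y)"
    using p L by (simp add: Lp_norm_eq_energy powr_mult powr_powr)
  assume "x \<noteq> y"
  then have "(c * real (word_dist \<Gamma> S x y) powr (p * \<alpha>)) powr (1 / p) \<le> Lp_energy p (\<lambda>t. f x t - f y t) powr (1 / p)"
    using low[OF xy] p c by (intro powr_mono2) auto
  then show "c powr (1 / p) * real (word_dist \<Gamma> S x y) powr \<alpha> \<le> Lp_norm p (\<lambda>t. f x t - f y t)"
    using p c by (simp add: Lp_norm_eq_energy powr_mult powr_powr)
qed (use f c in auto)

context generated_group
begin

text \<open>Send distinct elements to unit vectors in different blocks. This makes the set of exponents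
  nonempty.\<close>

lemma Lp_embeds_with_exponent_zero:
  assumes p: "1 \<le> p" and "countable (carrier \<Gamma>)"
  shows "Lp_embeds_with_exponent p \<Gamma> S 0"
proof -
  have p0: "0 < p"
    using p by simp
  define \<delta> :: "'a \<Rightarrow> 'a \<Rightarrow> real \<Rightarrow> real" where "\<delta> = (\<lambda>x z t. if z = x then 1 else 0)"
  have "\<exists>F. F \<in> carrier \<Gamma> \<rightarrow> Lp_space p \<and>
    (\<forall>x\<in>carrier \<Gamma>. \<forall>y\<in>carrier \<Gamma>. \<forall>D. finite D \<and> D \<subseteq> carrier \<Gamma> \<and> (\<forall>z\<in>carrier \<Gamma> - D. \<delta> x z = \<delta> y z) \<longrightarrow>
      Lp_energy p (\<lambda>t. F x t - F y t) = Lp_energy p (\<lambda>t. 0 - 0)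
        + (\<Sum>z\<in>D. Lp_energy p (\<lambda>t. \<delta> x z t - \<delta> y z t)))"
  proof (rule Lp_direct_sum[where \<phi> = "\<lambda>x t. 0", OF p0 assms(2)])
    fix x
    show "finite {z \<in> carrier \<Gamma>. \<delta> x z \<noteq> (\<lambda>t. 0)}"
      by (rule finite_subset[of _ "{x}"]) (auto simp: \<delta>_def fun_eq_iff split: if_splits)
  qed (simp_all add: \<delta>_def Lp_space_const)
  then obtain F where F: "F \<in> carrier \<Gamma> \<rightarrow> Lp_space p"
    and dist: "\<forall>x\<in>carrier \<Gamma>. \<forall>y\<in>carrier \<Gamma>. \<forall>D. finite D \<and> D \<subseteq> carrier \<Gamma> \<and> (\<forall>z\<in>carrier \<Gamma> - D. \<delta> x z = \<delta> y z) \<longrightarrow>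
      Lp_energy p (\<lambda>t. F x t - F y t) = Lp_energy p (\<lambda>t. 0 - 0)
        + (\<Sum>z\<in>D. Lp_energy p (\<lambda>t. \<delta> x z t - \<delta> y z t))"
    by (elim exE conjE) (rule that)
  have energy: "Lp_energy p (\<lambda>t. F x t - F y t) = 2" if "x \<in> carrier \<Gamma>" "y \<in> carrier \<Gamma>" "x \<noteq> y" for x y
    using dist[rule_format, of x y "{x, y}"] that
    by (simp add: \<delta>_def fun_eq_iff Lp_energy_const Lp_energy_zero)
  show ?thesis
  proof (rule Lp_embeds_energyI[OF p F, of 2 1])
    fix x y assume xy: "x \<in> carrier \<Gamma>" "y \<in> carrier \<Gamma>"
    show "Lp_energy p (\<lambda>t. F x t - F y t) \<le> 2 * real (word_dist \<Gamma> S x y) powr p"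
    proof (cases "x = y")
      case False
      then have "1 \<le> real (word_dist \<Gamma> S x y) powr p"
        using word_dist_ge_1[OF xy] p by (intro ge_one_powr_ge_zero) auto
      then show ?thesis
        using energy[OF xy False] by simp
    qed (simp add: Lp_energy_zero)
    assume "x \<noteq> y"
    then show "1 * real (word_dist \<Gamma> S x y) powr (p * 0) \<le> Lp_energy p (\<lambda>t. F x t - F y t)"
      using energy[OF xy] by simp
  qed auto
qed

text \<open>At distance \<open>n\<close> from the identity, \<open>c * n powr \<alpha> \<le> L * n\<close>, which for \<open>\<alpha> > 1\<close> bounds \<open>n\<close>.\<close>

lemma Lp_embeds_imp_exponent_le_1:
  assumes emb: "Lp_embeds_with_exponent p \<Gamma> S \<alpha>" and unb: "\<And>n. \<exists>x\<in>carrier \<Gamma>. n < len x"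
  shows "\<alpha> \<le> 1"
proof (rule ccontr)
  assume "\<not> \<alpha> \<le> 1"
  then have \<alpha>: "0 < \<alpha> - 1"
    by simp
  obtain f L c where c: "0 < c"
    and up: "\<forall>x\<in>carrier \<Gamma>. \<forall>y\<in>carrier \<Gamma>.
      Lp_norm p (\<lambda>t. f x t - f y t) \<le> L * real (word_dist \<Gamma> S x y)"
    and low: "\<forall>x\<in>carrier \<Gamma>. \<forall>y\<in>carrier \<Gamma>. x \<noteq> y \<longrightarrow>
      Lp_norm p (\<lambda>t. f x t - f y t) \<ge> c * real (word_dist \<Gamma> S x y) powr \<alpha>"
    using emb unfolding Lp_embeds_with_exponent_def by (elim exE conjE) (rule that)
  define R where "R = (max 1 (L / c)) powr (1 / (\<alpha> - 1))"
  obtain x where x: "x \<in> carrier \<Gamma>" and big: "nat \<lceil>R\<rceil> < len x"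
    using unb[of "nat \<lceil>R\<rceil>"] by auto
  define n where "n = real (len x)"
  have R: "R < n"
    using big unfolding n_def by linarith
  have n: "0 < n"
    using big by (simp add: n_def)
  have "\<one> \<noteq> x"
    using big len_one by auto
  then have "c * n powr \<alpha> \<le> L * n"
    using order_trans[OF low[rule_format, OF one_closed x] up[rule_format, OF one_closed x]] x by (simp add: n_def word_dist_def)
  moreover have "n powr \<alpha> = n powr (\<alpha> - 1) * n"
    using n powr_mult_base[of n "\<alpha> - 1"] by (simp add: mult.commute)
  ultimately have "(c * n powr (\<alpha> - 1)) * n \<le> L * n"
    by (simp add: mult.assoc)
  then have "c * n powr (\<alpha> - 1) \<le> L"
    using n by simp
  then have "n powr (\<alpha> - 1) \<le> L / c"
    using c by (simp add: pos_le_divide_eq mult.commute)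
  moreover have "R powr (\<alpha> - 1) < n powr (\<alpha> - 1)"
    using \<alpha> R by (intro powr_less_mono2) (auto simp: R_def)
  moreover have "R powr (\<alpha> - 1) = max 1 (L / c)"
    using \<alpha> by (simp add: R_def powr_powr)
  ultimately show False
    by simp
qed

lemma compression_exponent_upper:
  assumes "Lp_embeds_with_exponent p \<Gamma> S \<alpha>" "0 \<le> \<alpha>" and unb: "\<And>n. \<exists>x\<in>carrier \<Gamma>. n < len x"
  shows "\<alpha> \<le> compression_exponent p \<Gamma> S"
  unfolding compression_exponent_def
  using assms(1,2) Lp_embeds_imp_exponent_le_1[OF _ unb] by (intro cSup_upper bdd_aboveI[of _ 1]) auto

lemma compression_exponent_sequence:
  assumes p: "1 \<le> p" and "countable (carrier \<Gamma>)" and unb: "\<And>n. \<exists>x\<in>carrier \<Gamma>. n < len x"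
  shows "\<exists>a. (\<forall>n. 0 \<le> a n \<and> Lp_embeds_with_exponent p \<Gamma> S (a n)) \<and> a \<longlonglongrightarrow> compression_exponent p \<Gamma> S"
proof -
  let ?A = "{\<alpha>. \<alpha> \<ge> 0 \<and> Lp_embeds_with_exponent p \<Gamma> S \<alpha>}"
  have "?A \<noteq> {}"
    using Lp_embeds_with_exponent_zero[OF p assms(2)] by auto
  moreover have "bdd_above ?A"
    using Lp_embeds_imp_exponent_le_1[OF _ unb] by (intro bdd_aboveI[of _ 1]) auto
  ultimately have "compression_exponent p \<Gamma> S \<in> closure ?A"
    unfolding compression_exponent_def by (rule closure_contains_Sup)
  then show ?thesis
    unfolding closure_sequential by auto
qed

end

context wreath_product
begin

text \<open>The embedding is \<open>(f, x) \<mapsto> \<phi> (f, x)\<close> together with \<open>\<psi> (f z)\<close> for all \<open>z\<close> in \<open>H\<close>, where \<open>\<psi>\<close> is first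
  translated to vanish at the identity so that unlit lamps contribute nothing. Both Lipschitz bounds
  add up because \<open>p\<close>-th powers of distances are superadditive, and the lower bound is the inequality
  for power sums.\<close>

lemma wreath_Lp_embeds:
  assumes S: "finite S" "symmetric_generating_set G S" and T: "finite T" "symmetric_generating_set H T"
    and W: "finite W" "symmetric_generating_set (wreath G H) W"
    and p: "1 \<le> p" and ab: "0 \<le> a" "0 \<le> b"
    and embG: "Lp_embeds_with_exponent p G S a"
    and embL: "Lp_embeds_with_exponent p (wreath G H) (lamplighter_gens G H T) b"
  shows "Lp_embeds_with_exponent p (wreath G H) W (wreath_exponent p a b)"
proof -
  define \<theta> where "\<theta> = wreath_exponent p a b"
  have p0: "0 < p"
    using p by simp
  have \<theta>0: "0 \<le> p * \<theta>"
    using wreath_exponent_nonneg[OF p ab] p by (simp add: \<theta>_def)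
  interpret S: generated_group G S
    using symmetric_generating_set_imp_generated_group[OF G.is_group S(2)] .
  interpret T: generated_group H T
    using symmetric_generating_set_imp_generated_group[OF H.is_group T(2)] .
  interpret L: generated_group "wreath G H" "lamplighter_gens G H T"
    using generated_lamplighter[OF T(2)] .
  let ?dG = "word_dist G S" and ?dL = "word_dist (wreath G H) (lamplighter_gens G H T)"
    and ?dW = "word_dist (wreath G H) W" and ?X = "carrier (wreath G H)"
  obtain \<psi> LG cG where \<psi>: "\<psi> \<in> carrier G \<rightarrow> Lp_space p" and LG: "0 \<le> LG" and cG: "0 < cG"
    and \<psi>up: "\<And>x y. x \<in> carrier G \<Longrightarrow> y \<in> carrier G \<Longrightarrow>
      Lp_energy p (\<lambda>t. \<psi> x t - \<psi> y t) \<le> LG * real (?dG x y) powr p"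
    and \<psi>low: "\<And>x y. x \<in> carrier G \<Longrightarrow> y \<in> carrier G \<Longrightarrow> x \<noteq> y \<Longrightarrow>
      cG * real (?dG x y) powr (p * a) \<le> Lp_energy p (\<lambda>t. \<psi> x t - \<psi> y t)"
    by (rule Lp_embeds_energyE[OF embG p], rule that)
  obtain \<phi> LL cL where \<phi>: "\<phi> \<in> ?X \<rightarrow> Lp_space p" and LL: "0 \<le> LL" and cL: "0 < cL"
    and \<phi>up: "\<And>x y. x \<in> ?X \<Longrightarrow> y \<in> ?X \<Longrightarrow>
      Lp_energy p (\<lambda>t. \<phi> x t - \<phi> y t) \<le> LL * real (?dL x y) powr p"
    and \<phi>low: "\<And>x y. x \<in> ?X \<Longrightarrow> y \<in> ?X \<Longrightarrow> x \<noteq> y \<Longrightarrow>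
      cL * real (?dL x y) powr (p * b) \<le> Lp_energy p (\<lambda>t. \<phi> x t - \<phi> y t)"
    by (rule Lp_embeds_energyE[OF embL p], rule that)
  define \<psi>0 :: "(('h \<Rightarrow> 'g) \<times> 'h) \<Rightarrow> 'h \<Rightarrow> real \<Rightarrow> real" where "\<psi>0 = (\<lambda>u z t. \<psi> (fst u z) t - \<psi> \<one>\<^bsub>G\<^esub> t)"
  have "\<exists>F. F \<in> ?X \<rightarrow> Lp_space p \<and>
    (\<forall>u\<in>?X. \<forall>v\<in>?X. \<forall>D. finite D \<and> D \<subseteq> carrier H \<and> (\<forall>z\<in>carrier H - D. \<psi>0 u z = \<psi>0 v z) \<longrightarrow>
      Lp_energy p (\<lambda>t. F u t - F v t) = Lp_energy p (\<lambda>t. \<phi> u t - \<phi> v t)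
        + (\<Sum>z\<in>D. Lp_energy p (\<lambda>t. \<psi>0 u z t - \<psi>0 v z t)))"
  proof (rule Lp_direct_sum[OF p0 T.countable_carrier[OF T(1)]])
    fix u assume u: "u \<in> ?X"
    then show "\<phi> u \<in> Lp_space p"
      using \<phi> by auto
    have "finite (supp (fst u))"
      using u mem_wreath[of "fst u" "snd u"] by simp
    then show "finite {z \<in> carrier H. \<psi>0 u z \<noteq> (\<lambda>t. 0)}"
      by (rule rev_finite_subset) (auto simp: supp_def \<psi>0_def)
    fix z assume "z \<in> carrier H"
    then have "fst u z \<in> carrier G"
      using u wreath_val[of "fst u" "snd u" z] by simp
    then show "\<psi>0 u z \<in> Lp_space p"
      unfolding \<psi>0_def using \<psi> p0 by (intro Lp_space_diff) auto
  qed
  then obtain F where F: "F \<in> ?X \<rightarrow> Lp_space p"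
    and energy: "\<forall>u\<in>?X. \<forall>v\<in>?X. \<forall>D. finite D \<and> D \<subseteq> carrier H \<and> (\<forall>z\<in>carrier H - D. \<psi>0 u z = \<psi>0 v z) \<longrightarrow>
      Lp_energy p (\<lambda>t. F u t - F v t) = Lp_energy p (\<lambda>t. \<phi> u t - \<phi> v t)
        + (\<Sum>z\<in>D. Lp_energy p (\<lambda>t. \<psi>0 u z t - \<psi>0 v z t))"
    by (elim exE conjE) (rule that)
  have dist: "Lp_energy p (\<lambda>t. F (f, x) t - F (g, y) t) = Lp_energy p (\<lambda>t. \<phi> (f, x) t - \<phi> (g, y) t)
        + (\<Sum>z\<in>diff f g. Lp_energy p (\<lambda>t. \<psi> (f z) t - \<psi> (g z) t))"
    if fg: "(f, x) \<in> ?X" "(g, y) \<in> ?X" for f x g y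
  proof -
    have "\<forall>z\<in>carrier H - diff f g. \<psi>0 (f, x) z = \<psi>0 (g, y) z" "diff f g \<subseteq> carrier H"
      by (auto simp: diff_def \<psi>0_def)
    then have "Lp_energy p (\<lambda>t. F (f, x) t - F (g, y) t) = Lp_energy p (\<lambda>t. \<phi> (f, x) t - \<phi> (g, y) t)
        + (\<Sum>z\<in>diff f g. Lp_energy p (\<lambda>t. \<psi>0 (f, x) z t - \<psi>0 (g, y) z t))"
      using energy fg finite_diff[OF fg] by blast
    then show ?thesis
      by (simp add: \<psi>0_def)
  qed
  obtain K K' where K: "0 < K" "0 < K'"
    and card: "\<And>f x g y. (f, x) \<in> ?X \<Longrightarrow> (g, y) \<in> ?X \<Longrightarrow> card (diff f g) \<le> ?dL (f, x) (g, y)"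
    and dW_le: "\<And>f x g y. (f, x) \<in> ?X \<Longrightarrow> (g, y) \<in> ?X \<Longrightarrow>
      real (?dW (f, x) (g, y)) \<le> K * (real (?dL (f, x) (g, y)) + (\<Sum>z\<in>diff f g. real (?dG (f z) (g z))))"
    and dW_ge: "\<And>f x g y. (f, x) \<in> ?X \<Longrightarrow> (g, y) \<in> ?X \<Longrightarrow>
      real (?dL (f, x) (g, y)) + (\<Sum>z\<in>diff f g. real (?dG (f z) (g z))) \<le> K' * real (?dW (f, x) (g, y))"
    by (rule word_dist_comparison[OF S T W], rule that)
  have "Lp_embeds_with_exponent p (wreath G H) W \<theta>"
  proof (rule Lp_embeds_energyI[OF p F])
    show "0 \<le> (LL + LG) * K' powr p"
      using LL LG by simp
    show "0 < min cL cG / (2 * K) powr (p * \<theta>)"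
      using cL cG K by simp
  next
    fix u v assume uv: "u \<in> ?X" "v \<in> ?X"
    obtain f x g y where eq: "u = (f, x)" "v = (g, y)"
      by (cases u, cases v)
    note fg = uv[unfolded eq]
    define N where "N = real (?dL u v)"
    define d where "d = (\<lambda>z. real (?dG (f z) (g z)))"
    define D where "D = (\<Sum>z\<in>diff f g. d z)"
    have fin: "finite (diff f g)"
      using finite_diff[OF fg] .
    have val: "f z \<in> carrier G" "g z \<in> carrier G" "f z \<noteq> g z" if "z \<in> diff f g" for z
      using that wreath_val[OF fg(1)] wreath_val[OF fg(2)] by (auto simp: diff_def)
    have D0: "0 \<le> D"
      by (simp add: D_def d_def sum_nonneg)
    have N0: "0 \<le> N"
      by (simp add: N_def)
    have ge: "N + D \<le> K' * real (?dW u v)" and le: "real (?dW u v) \<le> K * (N + D)"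
      using dW_ge[OF fg] dW_le[OF fg] by (simp_all add: N_def D_def d_def eq)
    have E: "Lp_energy p (\<lambda>t. F u t - F v t) = Lp_energy p (\<lambda>t. \<phi> u t - \<phi> v t)
        + (\<Sum>z\<in>diff f g. Lp_energy p (\<lambda>t. \<psi> (f z) t - \<psi> (g z) t))"
      using dist[OF fg] by (simp add: eq)
    have "(\<Sum>z\<in>diff f g. Lp_energy p (\<lambda>t. \<psi> (f z) t - \<psi> (g z) t)) \<le> (\<Sum>z\<in>diff f g. LG * d z powr p)"
      unfolding d_def by (rule sum_mono) (rule \<psi>up[OF val(1,2)])
    also have "\<dots> = LG * (\<Sum>z\<in>diff f g. d z powr p)"
      by (simp add: sum_distrib_left)
    also have "\<dots> \<le> LG * D powr p"
      unfolding D_def using LG fin p by (intro mult_left_mono sum_powr_le_powr_sum) (auto simp: d_def)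
    also have "\<dots> \<le> LG * (N + D) powr p"
      using LG N0 D0 p by (intro mult_left_mono powr_mono2) auto
    finally have "Lp_energy p (\<lambda>t. F u t - F v t) \<le> LL * N powr p + LG * (N + D) powr p"
      using \<phi>up[OF uv] by (simp add: E N_def)
    also have "\<dots> \<le> LL * (N + D) powr p + LG * (N + D) powr p"
      using LL N0 D0 p by (intro add_right_mono mult_left_mono powr_mono2) auto
    also have "\<dots> = (LL + LG) * (N + D) powr p"
      by (simp add: distrib_right)
    also have "\<dots> \<le> (LL + LG) * (K' * real (?dW u v)) powr p"
      using LL LG ge N0 D0 p by (intro mult_left_mono powr_mono2) auto
    finally show "Lp_energy p (\<lambda>t. F u t - F v t) \<le> (LL + LG) * K' powr p * real (?dW u v) powr p"
      using K by (simp add: powr_mult mult.assoc)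
    assume "u \<noteq> v"
    then have N1: "1 \<le> N"
      using L.word_dist_ge_1[OF uv] by (simp add: N_def)
    let ?c = "min cL cG"
    have c0: "0 \<le> ?c"
      using cL cG by simp
    have "?c * max N D powr (p * \<theta>) \<le> ?c * (N powr (p * b) + (\<Sum>z\<in>diff f g. d z powr (p * a)))"
      unfolding D_def \<theta>_def
    proof (rule mult_left_mono[OF max_powr_wreath_exponent_le[OF fin _ _ N1 p ab] c0])
      show "1 \<le> d z" if "z \<in> diff f g" for z
        using S.word_dist_ge_1[OF val[OF that]] by (simp add: d_def)
      show "real (card (diff f g)) \<le> N"
        using card[OF fg] by (simp add: N_def eq)
    qed
    also have "\<dots> = ?c * N powr (p * b) + (\<Sum>z\<in>diff f g. ?c * d z powr (p * a))"
      by (simp add: distrib_left sum_distrib_left)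
    also have "\<dots> \<le> cL * N powr (p * b) + (\<Sum>z\<in>diff f g. cG * d z powr (p * a))"
      by (intro add_mono sum_mono mult_right_mono) auto
    also have "\<dots> \<le> Lp_energy p (\<lambda>t. F u t - F v t)"
      unfolding E N_def d_def using \<phi>low[OF uv \<open>u \<noteq> v\<close>] \<psi>low[OF val] by (intro add_mono sum_mono) auto
    finally have low: "?c * max N D powr (p * \<theta>) \<le> Lp_energy p (\<lambda>t. F u t - F v t)" .
    have "K * (N + D) \<le> K * (2 * max N D)"
      using K by (intro mult_left_mono) auto
    then have "real (?dW u v) \<le> 2 * K * max N D"
      using le by (simp add: mult.assoc mult.left_commute)
    then have "real (?dW u v) powr (p * \<theta>) \<le> (2 * K * max N D) powr (p * \<theta>)"
      using \<theta>0 by (intro powr_mono2) auto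
    then have "real (?dW u v) powr (p * \<theta>) \<le> (2 * K) powr (p * \<theta>) * max N D powr (p * \<theta>)"
      using K N0 by (simp add: powr_mult)
    then have "?c * real (?dW u v) powr (p * \<theta>) \<le> ?c * ((2 * K) powr (p * \<theta>) * max N D powr (p * \<theta>))"
      using c0 by (rule mult_left_mono)
    then have "?c / (2 * K) powr (p * \<theta>) * real (?dW u v) powr (p * \<theta>) \<le> ?c * max N D powr (p * \<theta>)"
      using K by (simp add: divide_le_eq mult.assoc mult.left_commute mult.commute)
    with low show "?c / (2 * K) powr (p * \<theta>) * real (?dW u v) powr (p * \<theta>) \<le> Lp_energy p (\<lambda>t. F u t - F v t)"
      by simp
  qed
  then show ?thesis
    by (simp add: \<theta>_def)
qed

text \<open>The generating set of the lamplighter group is infinite, so counting words does not help; but a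
  configuration with \<open>n\<close> lit lamps has length at least \<open>n\<close>.\<close>

lemma lamplighter_length_unbounded:
  assumes S: "finite S" "symmetric_generating_set G S" and T: "finite T" "symmetric_generating_set H T"
    and W: "symmetric_generating_set (wreath G H) W"
    and inf: "infinite (carrier G)" "infinite (carrier H)"
  shows "\<exists>u\<in>carrier (wreath G H). n < word_length (wreath G H) (lamplighter_gens G H T) u"
proof -
  obtain s where s: "s \<in> carrier G" "s \<noteq> \<one>\<^bsub>G\<^esub>"
    using inf(1) by (metis finite.emptyI finite_insert finite_subset insertI1 subsetI)
  obtain A where A: "A \<subseteq> carrier H" "finite A" "card A = Suc n"
    using infinite_arbitrarily_large[OF inf(2)] by metis
  let ?f = "\<lambda>z\<in>carrier H. if z \<in> A then s else \<one>\<^bsub>G\<^esub>"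
  have supp: "supp ?f = A"
    using A s by (auto simp: supp_def)
  have f: "(?f, \<one>\<^bsub>H\<^esub>) \<in> carrier (wreath G H)"
    using s A by (auto simp: mem_wreath supp)
  have "card (supp ?f) \<le> word_length (wreath G H) (lamplighter_gens G H T) (?f, \<one>\<^bsub>H\<^esub>)"
    by (rule wreath_length_upper[OF S T
          symmetric_generating_set_imp_generated_group[OF W.is_group W]]) (simp only: f)
  then have "n < word_length (wreath G H) (lamplighter_gens G H T) (?f, \<one>\<^bsub>H\<^esub>)"
    unfolding supp A(3) by (rule less_le_trans[OF lessI])
  then show ?thesis
    using f by (rule bexI)
qed

lemma infinite_wreath:
  assumes "infinite (carrier H)"
  shows "infinite (carrier (wreath G H))"
proof -
  have "inj_on move (carrier H)"
    by (simp add: inj_on_def move_def)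
  then have "infinite (move ` carrier H)"
    using assms finite_imageD by blast
  moreover have "move ` carrier H \<subseteq> carrier (wreath G H)"
    using move_closed by blast
  ultimately show ?thesis
    by (rule infinite_super[rotated])
qed

end

text \<open>When the smaller supremum exceeds \<open>1 / p\<close>, the approximating exponents do so eventually and the
  formula is continuous. When it is at most \<open>1 / p\<close>, the approximating exponents, being below their
  suprema, always fall under the minimum branch. At \<open>1 / p\<close> the two formulas agree, which settles the
  case where the exponents approach the threshold from below.\<close>

lemma wreath_exponent_limit_le:
  assumes p: "1 \<le> p" and a: "a \<longlonglongrightarrow> A" and b: "b \<longlonglongrightarrow> B"
    and ab: "\<And>n::nat. 0 \<le> a n" "\<And>n. 0 \<le> b n"
    and aA: "\<And>n. a n \<le> A" and bB: "\<And>n. b n \<le> B"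
    and bound: "\<And>n. wreath_exponent p (a n) (b n) \<le> w"
  shows "(min A B \<ge> 1 / p \<longrightarrow> w \<ge> p * A * B / (p * A + p * B - 1)) \<and>
         (min A B \<le> 1 / p \<longrightarrow> w \<ge> min A B)"
proof -
  have p0: "0 < p"
    using p by simp
  have low: "min A B \<le> w" if "min A B \<le> 1 / p"
  proof (rule LIMSEQ_le_const2[OF tendsto_min[OF a b]])
    have "min (a n) (b n) \<le> w" for n
    proof -
      have "min (a n) (b n) \<le> 1 / p"
        using that aA[of n] bB[of n] by (auto simp: min_def split: if_splits)
      then have "p * a n \<le> 1 \<or> p * b n \<le> 1"
        using p0 by (auto simp: min_def pos_le_divide_eq mult.commute split: if_splits)
      then show ?thesis
        using bound[of n] by (simp add: wreath_exponent_def)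
    qed
    then show "\<exists>N. \<forall>n\<ge>N. min (a n) (b n) \<le> w"
      by auto
  qed
  have high: "p * A * B / (p * A + p * B - 1) \<le> w" if ge: "1 / p \<le> min A B"
  proof (cases "1 / p = min A B")
    case True
    have w: "1 / p \<le> w"
      using True low by simp
    have pos: "0 < A" "0 < B"
      using ge p0 by (auto intro: less_le_trans[of 0 "1 / p"])
    from True have "p * A = 1 \<or> p * B = 1"
      using p0 by (auto simp: min_def field_simps split: if_splits)
    then have "p * A * B / (p * A + p * B - 1) = 1 / p"
      using pos p0 by (auto simp: field_simps)
    then show ?thesis
      using w by simp
  next
    case False
    then have lt: "1 / p < A" "1 / p < B"
      using ge by auto
    then have "0 < p * A - 1" "0 < p * B - 1"
      using p0 by (auto simp: pos_divide_less_eq mult.commute)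
    then have nz: "p * A + p * B - 1 \<noteq> 0"
      by linarith
    have "(\<lambda>n. p * a n * b n / (p * a n + p * b n - 1)) \<longlonglongrightarrow> p * A * B / (p * A + p * B - 1)"
      by (intro tendsto_intros a b nz)
    moreover have "\<forall>\<^sub>F n in sequentially. p * a n * b n / (p * a n + p * b n - 1) \<le> w"
      using order_tendstoD(1)[OF a lt(1)] order_tendstoD(1)[OF b lt(2)]
    proof eventually_elim
      case (elim n)
      then have "\<not> p * a n \<le> 1" "\<not> p * b n \<le> 1"
        using p0 by (auto simp: pos_divide_less_eq mult.commute)
      then show ?case
        using bound[of n] by (simp add: wreath_exponent_def)
    qed
    ultimately show ?thesis
      by (rule tendsto_upperbound) simp
  qed
  show ?thesis
    using low high by blast
qed

theorem theorem3p3: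
  fixes G :: "('g, 'm) monoid_scheme" and H :: "('h, 'n) monoid_scheme"
    and S :: "'g set" and T :: "'h set" and W :: "(('h \<Rightarrow> 'g) \<times> 'h) set" and p :: real
  assumes "group G" and "group H"
    and "infinite (carrier G)" and "infinite (carrier H)"
    and "finite S" and "symmetric_generating_set G S"
    and "finite T" and "symmetric_generating_set H T"
    and "finite W" and "symmetric_generating_set (wreath G H) W"
    and "1 \<le> p"
  defines "\<alpha>G \<equiv> compression_exponent p G S"
    and "\<alpha>L \<equiv> compression_exponent p (wreath G H) (lamplighter_gens G H T)"
    and "\<alpha>W \<equiv> compression_exponent p (wreath G H) W"
  shows "(min \<alpha>G \<alpha>L \<ge> 1 / p \<longrightarrow> \<alpha>W \<ge> p * \<alpha>G * \<alpha>L / (p * \<alpha>G + p * \<alpha>L - 1)) \<and>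
         (min \<alpha>G \<alpha>L \<le> 1 / p \<longrightarrow> \<alpha>W \<ge> min \<alpha>G \<alpha>L)"
proof -
  interpret wreath_product G H
    using assms(1,2) by (simp add: wreath_product_def)
  interpret GS: generated_group G S
    using symmetric_generating_set_imp_generated_group[OF assms(1,6)] .
  interpret L: generated_group "wreath G H" "lamplighter_gens G H T"
    using generated_lamplighter[OF assms(8)] .
  interpret WW: generated_group "wreath G H" W
    using symmetric_generating_set_imp_generated_group[OF W.is_group assms(10)] .
  note unbG = GS.len_unbounded[OF assms(5,3)]
  note unbL = lamplighter_length_unbounded[OF assms(5-8,10,3,4)]
  note unbW = WW.len_unbounded[OF assms(9) infinite_wreath[OF assms(4)]]
  obtain a where a: "\<And>n. 0 \<le> a n" "\<And>n. Lp_embeds_with_exponent p G S (a n)" "a \<longlonglongrightarrow> \<alpha>G"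
    unfolding \<alpha>G_def
    using GS.compression_exponent_sequence[OF assms(11) GS.countable_carrier[OF assms(5)] unbG] by blast
  obtain b where b: "\<And>n. 0 \<le> b n"
    "\<And>n. Lp_embeds_with_exponent p (wreath G H) (lamplighter_gens G H T) (b n)" "b \<longlonglongrightarrow> \<alpha>L"
    unfolding \<alpha>L_def
    using L.compression_exponent_sequence[OF assms(11) WW.countable_carrier[OF assms(9)] unbL] by blast
  show ?thesis
  proof (rule wreath_exponent_limit_le[OF assms(11) a(3) b(3) a(1) b(1)])
    fix n
    show "a n \<le> \<alpha>G"
      unfolding \<alpha>G_def using GS.compression_exponent_upper[OF a(2) a(1) unbG] .
    show "b n \<le> \<alpha>L"
      unfolding \<alpha>L_def using L.compression_exponent_upper[OF b(2) b(1) unbL] .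
    show "wreath_exponent p (a n) (b n) \<le> \<alpha>W"
      unfolding \<alpha>W_def
      using wreath_Lp_embeds[OF assms(5-11) a(1) b(1) a(2) b(2)]
        wreath_exponent_nonneg[OF assms(11) a(1) b(1)] unbW
      by (rule WW.compression_exponent_upper)
  qed
qed

end
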